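(* For every $n\ge1$, the following tangle systems have the finite model property over the indicated classes of frames: $\mathrm{K4G}_nt$ and $\mathrm{K4G}_nt\mathrm{.U}$ over locally $n$-connected transitive frames; $\mathrm{K4G}_nt\mathrm{.UC}$ over path-connected, locally $n$-connected transitive frames; $\mathrm{KD4G}_nt$ and $\mathrm{KD4G}_nt\mathrm{.U}$ over locally $n$-connected serial transitive frames; $\mathrm{KD4G}_nt\mathrm{.UC}$ over path-connected, locally $n$-connected serial transitive frames.
   Context: $\mathsf{Var}$ is a set of propositional variables. $\mathcal L_{\Box\forall}^{\langle t\rangle}$-formulas: atoms; $\top$; $\neg\varphi$; $\varphi\wedge\psi$; $\Box\varphi$; $\forall\varphi$; $\langle t\rangle\Gamma$ for each non-empty finite set $\Gamma$ of formulas. $\mathcal L_\Box^{\langle t\rangle}$ consists of the formulas not involving $\forall$. Abbreviations: $\vee,\to$ as usual, $\Diamond=\neg\Box\neg$, $\exists=\neg\forall\neg$, $\Box^*\varphi=\varphi\wedge\Box\varphi$, $\Diamond^*\varphi=\varphi\vee\Diamond\varphi$. Kripke semantics in $(W,R,h)$, $h:\mathsf{Var}\to\wp(W)$: atoms, $\top$, Booleans as usual; $\Box\varphi$ is true at $w$ iff $\varphi$ is true at all $v$ with $wRv$; $\forall\varphi$ is true at $w$ iff $\varphi$ is true at all $v\in W$; $\langle t\rangle\Gamma$ is true at $w$ iff there is an infinite sequence $w=w_0,w_1,\dots$ with $w_iRw_{i+1}$ for all $i$ such that each $\gamma\in\Gamma$ is true at $w_i$ for infinitely many $i$. A frame $(W,R)$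 has $W\neq\emptyset$, and is serial if every $w$ has some $v$ with $wRv$. Two points are path connected if joined by a finite sequence $w_0,\dots,w_m$ ($m\ge0$) with $w_iRw_{i+1}$ or $w_{i+1}Rw_i$ for each $i<m$; the equivalence classes are the path components. The frame is path-connected if it has one path component, and locally $n$-connected if for each $x\in W$, $R(x)=\{y:xRy\}$ with the restricted relation has at most $n$ path components. $\mathrm{K4}t$ (in $\mathcal L_\Box^{\langle t\rangle}$): axioms are all instances of propositional tautologies; $\Box(\varphi\to\psi)\to(\Box\varphi\to\Box\psi)$; $\Diamond\Diamond\varphi\to\Diamond\varphi$; (Fix) $\langle t\rangle\Gamma\to\Diamond(\gamma\wedge\langle t\rangle\Gamma)$ for $\gamma\in\Gamma$; (Ind) $\Box^*(\varphi\to\bigwedge_{\gamma\in\Gamma}\Diamond(\gamma\wedge\varphi))\to(\varphi\to\langle t\rangle\Gamma)$; rules modus ponens and from $\varphi$ infer $\Box\varphi$. $\mathrm G_n$ is the scheme of all formulas $\bigwedge_{i\le n}\Diamond Q_i\to\Diamond(\bigwedge_{i\le n}\Diamond^*\neg Q_i)$, where $Q_i=\varphi_i\wedge\bigwedge_{i\ne j\le n}\neg\varphi_j$ for arbitrary formulas $\varphi_0,\dots,\varphi_n$. $\mathrm{K4G}_nt$ is $\mathrm{K4}t$ plus $\mathrm G_n$; $\mathrm{KD4G}_nt$ adds $\Diamond\top$. Suffix $\mathrm{.U}$: schemes and rules are taken in $\mathcal L_{\Box\forall}^{\langle t\rangle}$ and one adds the S5 axioms for $\forall$ ($\forall(\varphi\to\psi)\to(\forall\varphi\to\forall\psi)$,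 $\forall\varphi\to\varphi$, $\forall\varphi\to\forall\forall\varphi$, $\varphi\to\forall\exists\varphi$), the rule from $\varphi$ infer $\forall\varphi$, and the scheme $\forall\varphi\to\Box\varphi$. Suffix $\mathrm{.UC}$: additionally the scheme $\forall(\Box^*\varphi\vee\Box^*\neg\varphi)\to(\forall\varphi\vee\forall\neg\varphi)$. A formula is consistent with a system $H$ if its negation is not a theorem of $H$. $H$ has the finite model property over a class $\mathcal K$ of frames if each $H$-consistent formula is true at some world of some model on a finite frame in $\mathcal K$. *)

theory Defs
  imports "HOL-Library.FSet"
begin

section \<open>Formulas\<close>

text \<open>The datatype admits the tangle of the empty set; the languages
  \<open>lang_all\<close> and \<open>lang_box\<close> below exclude it.\<close>

datatype 'v fm =
    Atom 'v
  | Top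
  | Neg "'v fm"
  | And "'v fm" "'v fm"
  | Box "'v fm"
  | Univ "'v fm"
  | Tangle "'v fm fset"

abbreviation Or :: "'v fm \<Rightarrow> 'v fm \<Rightarrow> 'v fm" where
  "Or \<phi> \<psi> \<equiv> Neg (And (Neg \<phi>) (Neg \<psi>))"

abbreviation Imp :: "'v fm \<Rightarrow> 'v fm \<Rightarrow> 'v fm" where
  "Imp \<phi> \<psi> \<equiv> Neg (And \<phi> (Neg \<psi>))"

abbreviation Dia :: "'v fm \<Rightarrow> 'v fm" where
  "Dia \<phi> \<equiv> Neg (Box (Neg \<phi>))"

abbreviation Exi :: "'v fm \<Rightarrow> 'v fm" where
  "Exi \<phi> \<equiv> Neg (Univ (Neg \<phi>))"

abbreviation BoxS :: "'v fm \<Rightarrow> 'v fm" where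
  "BoxS \<phi> \<equiv> And \<phi> (Box \<phi>)"

abbreviation DiaS :: "'v fm \<Rightarrow> 'v fm" where
  "DiaS \<phi> \<equiv> Or \<phi> (Dia \<phi>)"

primrec Conj :: "'v fm list \<Rightarrow> 'v fm" where
  "Conj [] = Top"
| "Conj (\<phi> # \<phi>s) = And \<phi> (Conj \<phi>s)"

inductive_set lang_all :: "'v fm set" where
  "Atom p \<in> lang_all"
| "Top \<in> lang_all"
| "\<phi> \<in> lang_all \<Longrightarrow> Neg \<phi> \<in> lang_all"
| "\<phi> \<in> lang_all \<Longrightarrow> \<psi> \<in> lang_all \<Longrightarrow> And \<phi> \<psi> \<in> lang_all"
| "\<phi> \<in> lang_all \<Longrightarrow> Box \<phi> \<in> lang_all"
| "\<phi> \<in> lang_all \<Longrightarrow> Univ \<phi> \<in> lang_all"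
| "\<Gamma> \<noteq> {||} \<Longrightarrow> (\<And>\<gamma>. \<gamma> \<in> fset \<Gamma> \<Longrightarrow> \<gamma> \<in> lang_all) \<Longrightarrow> Tangle \<Gamma> \<in> lang_all"

inductive_set lang_box :: "'v fm set" where
  "Atom p \<in> lang_box"
| "Top \<in> lang_box"
| "\<phi> \<in> lang_box \<Longrightarrow> Neg \<phi> \<in> lang_box"
| "\<phi> \<in> lang_box \<Longrightarrow> \<psi> \<in> lang_box \<Longrightarrow> And \<phi> \<psi> \<in> lang_box"
| "\<phi> \<in> lang_box \<Longrightarrow> Box \<phi> \<in> lang_box"
| "\<Gamma> \<noteq> {||} \<Longrightarrow> (\<And>\<gamma>. \<gamma> \<in> fset \<Gamma> \<Longrightarrow> \<gamma> \<in> lang_box) \<Longrightarrow> Tangle \<Gamma> \<in> lang_box"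


section \<open>Kripke semantics\<close>

type_synonym 'w frame = "'w set \<times> ('w \<times> 'w) set"

lemma size_less_Tangle [termination_simp]:
  assumes "\<gamma> \<in> fset \<Gamma>"
  shows "size \<gamma> < Suc (\<Sum>\<delta>\<in>fset \<Gamma>. Suc (size \<delta>))"
proof -
  have "Suc (size \<gamma>) \<le> (\<Sum>\<delta>\<in>fset \<Gamma>. Suc (size \<delta>))"
    using assms by (intro member_le_sum) auto
  then show ?thesis by simp
qed

fun sat :: "'w frame \<Rightarrow> ('v \<Rightarrow> 'w set) \<Rightarrow> 'w \<Rightarrow> 'v fm \<Rightarrow> bool" where
  "sat F h w (Atom p) \<longleftrightarrow> w \<in> h p"
| "sat F h w Top \<longleftrightarrow> True"
| "sat F h w (Neg \<phi>) \<longleftrightarrow> \<not> sat F h w \<phi>"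
| "sat F h w (And \<phi> \<psi>) \<longleftrightarrow> sat F h w \<phi> \<and> sat F h w \<psi>"
| "sat F h w (Box \<phi>) \<longleftrightarrow> (\<forall>v. (w, v) \<in> snd F \<longrightarrow> sat F h v \<phi>)"
| "sat F h w (Univ \<phi>) \<longleftrightarrow> (\<forall>v\<in>fst F. sat F h v \<phi>)"
| "sat F h w (Tangle \<Gamma>) \<longleftrightarrow>
     (\<exists>s :: nat \<Rightarrow> 'w. s 0 = w \<and> (\<forall>i. (s i, s (Suc i)) \<in> snd F) \<and>
        (\<forall>\<gamma>\<in>fset \<Gamma>. infinite {i. sat F h (s i) \<gamma>}))"

definition is_frame :: "'w frame \<Rightarrow> bool" where
  "is_frame F \<longleftrightarrow> fst F \<noteq> {} \<and> snd F \<subseteq> fst F \<times> fst F"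

definition serial_frame :: "'w frame \<Rightarrow> bool" where
  "serial_frame F \<longleftrightarrow> (\<forall>w\<in>fst F. \<exists>v. (w, v) \<in> snd F)"

definition path_rel :: "'w frame \<Rightarrow> ('w \<times> 'w) set" where
  "path_rel F = (snd F \<union> (snd F)\<inverse>)\<^sup>* \<inter> (fst F \<times> fst F)"

definition path_components :: "'w frame \<Rightarrow> 'w set set" where
  "path_components F = fst F // path_rel F"

definition path_connected_frame :: "'w frame \<Rightarrow> bool" where
  "path_connected_frame F \<longleftrightarrow> card (path_components F) = 1"

definition restrict_frame :: "'w frame \<Rightarrow> 'w set \<Rightarrow> 'w frame" where
  "restrict_frame F A = (A, snd F \<inter> (A \<times> A))"

definition locally_connected :: "nat \<Rightarrow> 'w frame \<Rightarrow> bool" where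
  "locally_connected n F \<longleftrightarrow>
     (\<forall>x\<in>fst F. finite (path_components (restrict_frame F (snd F `` {x})))
             \<and> card (path_components (restrict_frame F (snd F `` {x}))) \<le> n)"


section \<open>Axiom schemes\<close>

text \<open>Propositional tautologies over a countable stock of variables; their instances are
  obtained by substituting formulas for the variables.\<close>

datatype pfm = PVar nat | PTop | PNeg pfm | PAnd pfm pfm

primrec pval :: "(nat \<Rightarrow> bool) \<Rightarrow> pfm \<Rightarrow> bool" where
  "pval e (PVar k) \<longleftrightarrow> e k"
| "pval e PTop \<longleftrightarrow> True"
| "pval e (PNeg a) \<longleftrightarrow> \<not> pval e a"
| "pval e (PAnd a b) \<longleftrightarrow> pval e a \<and> pval e b"

primrec psubst :: "(nat \<Rightarrow> 'v fm) \<Rightarrow> pfm \<Rightarrow> 'v fm" where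
  "psubst \<sigma> (PVar k) = \<sigma> k"
| "psubst \<sigma> PTop = Top"
| "psubst \<sigma> (PNeg a) = Neg (psubst \<sigma> a)"
| "psubst \<sigma> (PAnd a b) = And (psubst \<sigma> a) (psubst \<sigma> b)"

definition tautology :: "pfm \<Rightarrow> bool" where
  "tautology a \<longleftrightarrow> (\<forall>e. pval e a)"

text \<open>Schemes are functions of the language in which they are instantiated.\<close>

type_synonym 'v scheme = "'v fm set \<Rightarrow> 'v fm set"

text \<open>In \<open>Ind\<close>, the conjunction over the finite set \<open>\<Gamma>\<close> may be formed along
  any list enumerating \<open>\<Gamma>\<close>.\<close>

inductive_set K4t :: "'v scheme" for L where
  Taut: "tautology a \<Longrightarrow> psubst \<sigma> a \<in> L \<Longrightarrow> psubst \<sigma> a \<in> K4t L"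
| K: "\<phi> \<in> L \<Longrightarrow> \<psi> \<in> L \<Longrightarrow> Imp (Box (Imp \<phi> \<psi>)) (Imp (Box \<phi>) (Box \<psi>)) \<in> K4t L"
| Four: "\<phi> \<in> L \<Longrightarrow> Imp (Dia (Dia \<phi>)) (Dia \<phi>) \<in> K4t L"
| Fix: "Tangle \<Gamma> \<in> L \<Longrightarrow> \<gamma> \<in> fset \<Gamma> \<Longrightarrow>
    Imp (Tangle \<Gamma>) (Dia (And \<gamma> (Tangle \<Gamma>))) \<in> K4t L"
| Ind: "Tangle \<Gamma> \<in> L \<Longrightarrow> \<phi> \<in> L \<Longrightarrow> set \<gamma>s = fset \<Gamma> \<Longrightarrow>
    Imp (BoxS (Imp \<phi> (Conj (map (\<lambda>\<gamma>. Dia (And \<gamma> \<phi>)) \<gamma>s)))) (Imp \<phi> (Tangle \<Gamma>)) \<in> K4t L"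

definition G_Q :: "nat \<Rightarrow> (nat \<Rightarrow> 'v fm) \<Rightarrow> nat \<Rightarrow> 'v fm" where
  "G_Q n \<phi> i = And (\<phi> i) (Conj (map (\<lambda>j. Neg (\<phi> j)) (filter (\<lambda>j. j \<noteq> i) [0..<Suc n])))"

definition G_axioms :: "nat \<Rightarrow> 'v scheme" where
  "G_axioms n L = {Imp (Conj (map (\<lambda>i. Dia (G_Q n \<phi> i)) [0..<Suc n]))
                (Dia (Conj (map (\<lambda>i. DiaS (Neg (G_Q n \<phi> i))) [0..<Suc n])))
            | \<phi>. \<forall>i\<le>n. \<phi> i \<in> L}"

definition K4Gt :: "nat \<Rightarrow> 'v scheme" where
  "K4Gt n L = K4t L \<union> G_axioms n L"

definition KD4Gt :: "nat \<Rightarrow> 'v scheme" where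
  "KD4Gt n L = K4Gt n L \<union> {Dia Top}"

inductive_set U_axioms :: "'v scheme" for L where
  Univ_K: "\<phi> \<in> L \<Longrightarrow> \<psi> \<in> L \<Longrightarrow> Imp (Univ (Imp \<phi> \<psi>)) (Imp (Univ \<phi>) (Univ \<psi>)) \<in> U_axioms L"
| Univ_T: "\<phi> \<in> L \<Longrightarrow> Imp (Univ \<phi>) \<phi> \<in> U_axioms L"
| Univ_4: "\<phi> \<in> L \<Longrightarrow> Imp (Univ \<phi>) (Univ (Univ \<phi>)) \<in> U_axioms L"
| Univ_B: "\<phi> \<in> L \<Longrightarrow> Imp \<phi> (Univ (Exi \<phi>)) \<in> U_axioms L"
| Univ_Box: "\<phi> \<in> L \<Longrightarrow> Imp (Univ \<phi>) (Box \<phi>) \<in> U_axioms L"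

definition C_axioms :: "'v scheme" where
  "C_axioms L = {Imp (Univ (Or (BoxS \<phi>) (BoxS (Neg \<phi>)))) (Or (Univ \<phi>) (Univ (Neg \<phi>))) | \<phi>. \<phi> \<in> L}"


section \<open>Systems\<close>

text \<open>\<open>necs\<close> is the set of operators \<open>N\<close> for which \<open>N \<phi>\<close> may be
  inferred from \<open>\<phi>\<close>.\<close>

record 'v system =
  lang :: "'v fm set"
  axms :: "'v fm set"
  necs :: "('v fm \<Rightarrow> 'v fm) set"

inductive_set theorems_of :: "'v system \<Rightarrow> 'v fm set" for H where
  ax: "\<phi> \<in> axms H \<Longrightarrow> \<phi> \<in> theorems_of H"
| mp: "Imp \<phi> \<psi> \<in> theorems_of H \<Longrightarrow> \<phi> \<in> theorems_of H \<Longrightarrow> \<psi> \<in> theorems_of H"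
| nec: "\<phi> \<in> theorems_of H \<Longrightarrow> N \<in> necs H \<Longrightarrow> N \<phi> \<in> theorems_of H"

definition sys :: "'v scheme \<Rightarrow> 'v system" where
  "sys S = \<lparr>lang = lang_box, axms = S lang_box, necs = {Box}\<rparr>"

definition sys_U :: "'v scheme \<Rightarrow> 'v system" where
  "sys_U S = \<lparr>lang = lang_all, axms = S lang_all \<union> U_axioms lang_all, necs = {Box, Univ}\<rparr>"

definition sys_UC :: "'v scheme \<Rightarrow> 'v system" where
  "sys_UC S = \<lparr>lang = lang_all, axms = S lang_all \<union> U_axioms lang_all \<union> C_axioms lang_all,
     necs = {Box, Univ}\<rparr>"

definition consistent :: "'v system \<Rightarrow> 'v fm \<Rightarrow> bool" where
  "consistent H \<phi> \<longleftrightarrow> Neg \<phi> \<notin> theorems_of H"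

text \<open>Every finite frame is isomorphic to one whose worlds are natural numbers, so it loses no
  generality to draw the finite frames from \<open>nat frame\<close>.\<close>

definition finite_model_property :: "'v system \<Rightarrow> nat frame set \<Rightarrow> bool" where
  "finite_model_property H \<K> \<longleftrightarrow>
     (\<forall>\<phi>\<in>lang H. consistent H \<phi> \<longrightarrow>
        (\<exists>F\<in>\<K>. finite (fst F) \<and>
           (\<exists>h. (\<forall>p. h p \<subseteq> fst F) \<and> (\<exists>w\<in>fst F. sat F h w \<phi>))))"

definition lc_trans_frames :: "nat \<Rightarrow> 'w frame set" where
  "lc_trans_frames n = {F. is_frame F \<and> trans (snd F) \<and> locally_connected n F}"

end

theory Submission
  imports Defs "HOL-Library.Nat_Bijection"
begin

text \<open>A formula consistent with one of the systems belongs to some maximal consistent set, so it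
  suffices to collapse a canonical model to a finite model without changing the truth of the
  finitely many subformulas of that formula. Two things can go wrong in an ordinary filtration.
  Filtering merges paths, so tangles become true that were false; and it merges or adds
  successors in a way that may split the set of successors of a point into too many path
  components. Both are cured by the choice of the finite quotient.

  The boxes of \<open>\<Phi>\<close> that fail at a world and the tangles of \<open>\<Phi>\<close> that hold there can only
  become fewer along the accessibility relation (\<open>demands_mono\<close>). This gives every world a rank
  that never increases, and the \<open>cluster\<close> of a world records, by recursion on the rank, its own
  demands together with all clusters of smaller rank that it can see. A point of the finite frame
  is a cluster together with the set of formulas of \<open>\<Phi>\<close> true at the world (\<open>node\<close>). There are
  finitely many points and each set of points is defined by a formula
  (\<open>discernible_node\<close>), so the schemes of the logic may speak about sets of points.

  In every cluster one world \<open>rep\<close> is chosen that sees as few points of its own cluster as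
  possible, and all points of the cluster are given exactly the successors that this world sees;
  the frame is the transitive closure. Minimality and the scheme \<open>Ind\<close>, applied to the formula
  that defines the cluster, show that a tangle failing in a cluster has a member that fails at
  every successor of the representative inside the cluster (\<open>critical\<close>). An infinite path finally stays in
  one cluster, and then visits only such successors; hence the truth lemma \<open>truth\<close>.

  For connectedness the key fact is \<open>invariant_along_R\<close>: if \<open>y\<close> is accessible from \<open>x\<close>, the
  points of \<open>x\<close> and \<open>y\<close> are path connected inside any upward closed set containing both. For
  a cluster remembers the clusters of smaller rank in sight, so either the representative of \<open>x\<close> sees the cluster of
  \<open>y\<close>, or the two clusters agree or their representatives see a common one; and two points of
  one cluster have the same successors. If the successors
  of a point fell into more than \<open>n\<close> components, \<open>G\<^sub>n\<close> at the representative would yield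
  a successor together with one of its own successors in different components. In the same way
  the scheme for connectedness excludes a frame with two components.\<close>

section \<open>Languages and abstract worlds\<close>

locale language =
  fixes L :: "'v fm set"
  assumes Top_L [simp]: "Top \<in> L"
    and Neg_L [simp]: "Neg \<phi> \<in> L \<longleftrightarrow> \<phi> \<in> L"
    and And_L [simp]: "And \<phi> \<psi> \<in> L \<longleftrightarrow> \<phi> \<in> L \<and> \<psi> \<in> L"
    and Box_L [simp]: "Box \<phi> \<in> L \<longleftrightarrow> \<phi> \<in> L"
    and Univ_L: "Univ \<phi> \<in> L \<Longrightarrow> \<phi> \<in> L"
    and Tangle_L: "Tangle \<Gamma> \<in> L \<Longrightarrow> \<Gamma> \<noteq> {||} \<and> fset \<Gamma> \<subseteq> L"
begin

lemma Conj_L [simp]: "Conj \<phi>s \<in> L \<longleftrightarrow> set \<phi>s \<subseteq> L"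
  by (induction \<phi>s) auto

end

text \<open>The properties of a canonical model that the collapse to a finite model relies on. They hold for the
  full canonical model of a language without \<open>Univ\<close> and for an equivalence class of
  \<open>Univ\<close> in the canonical model of the full language, so that one construction serves all
  systems.\<close>

locale tangle_worlds = language L for L :: "'v fm set" +
  fixes W :: "'v fm set set" and R :: "('v fm set \<times> 'v fm set) set"
  assumes R_W: "(x, y) \<in> R \<Longrightarrow> x \<in> W \<and> y \<in> W"
    and R_trans: "(x, y) \<in> R \<Longrightarrow> (y, z) \<in> R \<Longrightarrow> (x, z) \<in> R"
    and Top_in [simp]: "x \<in> W \<Longrightarrow> Top \<in> x"
    and Neg_in [simp]: "x \<in> W \<Longrightarrow> \<phi> \<in> L \<Longrightarrow> Neg \<phi> \<in> x \<longleftrightarrow> \<phi> \<notin> x"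
    and And_in [simp]: "x \<in> W \<Longrightarrow> \<phi> \<in> L \<Longrightarrow> \<psi> \<in> L \<Longrightarrow> And \<phi> \<psi> \<in> x \<longleftrightarrow> \<phi> \<in> x \<and> \<psi> \<in> x"
    and Box_in: "x \<in> W \<Longrightarrow> \<phi> \<in> L \<Longrightarrow> Box \<phi> \<in> x \<longleftrightarrow> (\<forall>y. (x, y) \<in> R \<longrightarrow> \<phi> \<in> y)"
    and Univ_in: "x \<in> W \<Longrightarrow> Univ \<phi> \<in> L \<Longrightarrow> Univ \<phi> \<in> x \<longleftrightarrow> (\<forall>y\<in>W. \<phi> \<in> y)"
    and Fix_in: "x \<in> W \<Longrightarrow> Tangle \<Gamma> \<in> L \<Longrightarrow> Tangle \<Gamma> \<in> x \<Longrightarrow> \<gamma> \<in> fset \<Gamma> \<Longrightarrow>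
      \<exists>y. (x, y) \<in> R \<and> \<gamma> \<in> y \<and> Tangle \<Gamma> \<in> y"
    and Ind_in: "x \<in> W \<Longrightarrow> Tangle \<Gamma> \<in> L \<Longrightarrow> \<phi> \<in> L \<Longrightarrow> \<phi> \<in> x \<Longrightarrow>
      (\<And>y \<gamma>. y = x \<or> (x, y) \<in> R \<Longrightarrow> \<phi> \<in> y \<Longrightarrow> \<gamma> \<in> fset \<Gamma> \<Longrightarrow> \<exists>z. (y, z) \<in> R \<and> \<gamma> \<in> z \<and> \<phi> \<in> z) \<Longrightarrow>
      Tangle \<Gamma> \<in> x"
begin

lemma Dia_in: "x \<in> W \<Longrightarrow> \<phi> \<in> L \<Longrightarrow> Dia \<phi> \<in> x \<longleftrightarrow> (\<exists>y. (x, y) \<in> R \<and> \<phi> \<in> y)"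
  using Box_in[of x "Neg \<phi>"] R_W by auto

lemma Imp_in: "x \<in> W \<Longrightarrow> \<phi> \<in> L \<Longrightarrow> \<psi> \<in> L \<Longrightarrow> Imp \<phi> \<psi> \<in> x \<longleftrightarrow> (\<phi> \<in> x \<longrightarrow> \<psi> \<in> x)"
  by auto

lemma Conj_in [simp]: "x \<in> W \<Longrightarrow> set \<phi>s \<subseteq> L \<Longrightarrow> Conj \<phi>s \<in> x \<longleftrightarrow> set \<phi>s \<subseteq> x"
  by (induction \<phi>s) auto

text \<open>A world from which the tangle can be reached can, by \<open>Fix\<close>, reach each member of \<open>\<Gamma>\<close>
  at a world from which the tangle can still be reached; so \<open>Ind\<close> applies to
  \<open>Dia (Tangle \<Gamma>)\<close>.\<close>

lemma Tangle_back:
  assumes "(x, y) \<in> R" "Tangle \<Gamma> \<in> L" "Tangle \<Gamma> \<in> y"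
  shows "Tangle \<Gamma> \<in> x"
proof (rule Ind_in[where \<phi> = "Dia (Tangle \<Gamma>)"])
  show "x \<in> W" "Tangle \<Gamma> \<in> L" "Dia (Tangle \<Gamma>) \<in> L" using assms R_W by auto
  then show "Dia (Tangle \<Gamma>) \<in> x" using assms by (auto simp: Dia_in simp del: Neg_in)
  fix w \<gamma> assume w: "w = x \<or> (x, w) \<in> R" "Dia (Tangle \<Gamma>) \<in> w" "\<gamma> \<in> fset \<Gamma>"
  then have "w \<in> W" using R_W assms by blast
  then obtain v where v: "(w, v) \<in> R" "Tangle \<Gamma> \<in> v"
    using w assms(2) Dia_in by blast
  then obtain u where u: "(v, u) \<in> R" "\<gamma> \<in> u" "Tangle \<Gamma> \<in> u"
    using Fix_in[of v \<Gamma> \<gamma>] R_W assms w by blast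
  then obtain t where "(u, t) \<in> R" "Tangle \<Gamma> \<in> t"
    using Fix_in[of u \<Gamma> \<gamma>] R_W assms w by blast
  then have "Dia (Tangle \<Gamma>) \<in> u" using R_W assms(2) Dia_in by blast
  then show "\<exists>z. (w, z) \<in> R \<and> \<gamma> \<in> z \<and> Dia (Tangle \<Gamma>) \<in> z"
    using u v R_trans by blast
qed

section \<open>Definable properties of worlds\<close>

definition definable :: "('v fm set \<Rightarrow> bool) \<Rightarrow> bool" where
  "definable P \<longleftrightarrow> (\<exists>\<phi>\<in>L. \<forall>x\<in>W. \<phi> \<in> x \<longleftrightarrow> P x)"

text \<open>Maps with finitely many values and definable fibres. Every invariant of worlds used below is
  assembled from simpler ones by pairing, post-composition and collecting the values at
  successors, so closure under these operations makes all of them definable.\<close>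

definition discernible :: "('v fm set \<Rightarrow> 'b) \<Rightarrow> bool" where
  "discernible g \<longleftrightarrow> finite (g ` W) \<and> (\<forall>c. definable (\<lambda>x. g x = c))"

lemma definable_mem: "\<phi> \<in> L \<Longrightarrow> definable (\<lambda>x. \<phi> \<in> x)"
  unfolding definable_def by blast

lemma definable_cong: "(\<And>x. x \<in> W \<Longrightarrow> P x = Q x) \<Longrightarrow> definable P \<Longrightarrow> definable Q"
  unfolding definable_def by auto

lemma definable_not: "definable P \<Longrightarrow> definable (\<lambda>x. \<not> P x)"
  unfolding definable_def by (metis Neg_L Neg_in)

lemma definable_const: "definable (\<lambda>x. b)"
proof (cases b)
  case True
  then show ?thesis using definable_mem[OF Top_L] by (auto elim: definable_cong[rotated])
next
  case False
  then show ?thesis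
    using definable_not[OF definable_mem[OF Top_L]] by (auto elim: definable_cong[rotated])
qed

lemma definable_and: "definable P \<Longrightarrow> definable Q \<Longrightarrow> definable (\<lambda>x. P x \<and> Q x)"
  unfolding definable_def by (metis And_L And_in)

lemma definable_ball:
  "finite A \<Longrightarrow> (\<And>a. a \<in> A \<Longrightarrow> definable (P a)) \<Longrightarrow> definable (\<lambda>x. \<forall>a\<in>A. P a x)"
  by (induction A rule: finite_induct) (auto intro: definable_const definable_and)

lemma definable_bex:
  assumes "finite A" "\<And>a. a \<in> A \<Longrightarrow> definable (P a)"
  shows "definable (\<lambda>x. \<exists>a\<in>A. P a x)"
  using definable_not[OF definable_ball[of A "\<lambda>a x. \<not> P a x"]] assms definable_not by auto

lemma definable_dia:
  assumes "definable P"
  shows "definable (\<lambda>x. \<exists>y. (x, y) \<in> R \<and> P y)"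
proof -
  obtain \<phi> where "\<phi> \<in> L" "\<forall>x\<in>W. \<phi> \<in> x \<longleftrightarrow> P x" using assms unfolding definable_def by blast
  then have "Dia \<phi> \<in> x \<longleftrightarrow> (\<exists>y. (x, y) \<in> R \<and> P y)" if "x \<in> W" for x
    unfolding Dia_in[OF that \<open>\<phi> \<in> L\<close>] using R_W by blast
  moreover have "Dia \<phi> \<in> L" using \<open>\<phi> \<in> L\<close> by simp
  ultimately show ?thesis unfolding definable_def by blast
qed

lemma discernible_definable:
  assumes "discernible g" shows "definable (\<lambda>x. P (g x))"
proof -
  have "definable (\<lambda>x. \<exists>a\<in>g ` W \<inter> {a. P a}. g x = a)"
    using assms by (intro definable_bex) (auto simp: discernible_def)
  then show ?thesis by (rule definable_cong[rotated]) auto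
qed

lemma discernible_cong:
  assumes "\<And>x. x \<in> W \<Longrightarrow> g x = h x" "discernible g" shows "discernible h"
proof -
  have "g ` W = h ` W" using assms(1) by (rule image_cong[OF refl])
  moreover have "definable (\<lambda>x. h x = c)" if "definable (\<lambda>x. g x = c)" for c
    using assms(1) by (intro definable_cong[OF _ that]) simp
  ultimately show ?thesis using assms(2) by (simp add: discernible_def)
qed

lemma discernible_of_definable: "definable P \<Longrightarrow> discernible P"
proof -
  assume P: "definable P"
  have "definable (\<lambda>x. P x = c)" for c using P definable_not[OF P] by (cases c) auto
  then show ?thesis by (simp add: discernible_def)
qed

lemma discernible_comp: "discernible g \<Longrightarrow> discernible (\<lambda>x. h (g x))"
  using discernible_definable[of g]
  by (auto simp: discernible_def image_image[symmetric, of h g])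

lemma discernible_pair:
  assumes "discernible g" "discernible h" shows "discernible (\<lambda>x. (g x, h x))"
  unfolding discernible_def
proof
  have "(\<lambda>x. (g x, h x)) ` W \<subseteq> g ` W \<times> h ` W" by auto
  then show "finite ((\<lambda>x. (g x, h x)) ` W)"
    using assms by (meson discernible_def finite_SigmaI finite_subset)
  show "\<forall>c. definable (\<lambda>x. (g x, h x) = c)"
    using assms definable_and by (auto simp: discernible_def)
qed

lemma discernible_successors:
  assumes "discernible g" shows "discernible (\<lambda>x. g ` (R `` {x}))"
  unfolding discernible_def
proof
  have "(\<lambda>x. g ` (R `` {x})) ` W \<subseteq> Pow (g ` W)" using R_W by blast
  then show "finite ((\<lambda>x. g ` (R `` {x})) ` W)"
    using assms by (meson discernible_def finite_Pow_iff finite_subset)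
  have D: "definable (\<lambda>x. (\<exists>y. (x, y) \<in> R \<and> g y = a) = (a \<in> c))" for a c
  proof -
    have *: "definable (\<lambda>x. \<exists>y. (x, y) \<in> R \<and> g y = a)"
      using assms by (intro definable_dia) (simp add: discernible_def)
    show ?thesis using * definable_not[OF *] by (cases "a \<in> c") simp_all
  qed
  show "\<forall>c. definable (\<lambda>x. g ` (R `` {x}) = c)"
  proof
    fix c
    show "definable (\<lambda>x. g ` (R `` {x}) = c)"
    proof (cases "c \<subseteq> g ` W")
      case True
      have "definable (\<lambda>x. \<forall>a\<in>g ` W. (\<exists>y. (x, y) \<in> R \<and> g y = a) = (a \<in> c))"
        using assms by (intro definable_ball D) (auto simp: discernible_def)
      moreover have "(\<forall>a\<in>g ` W. (\<exists>y. (x, y) \<in> R \<and> g y = a) = (a \<in> c)) \<longleftrightarrow> g ` (R `` {x}) = c"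
        for x
      proof -
        have *: "(\<forall>a\<in>G. (a \<in> S) = (a \<in> c)) \<longleftrightarrow> S = c" if "S \<subseteq> G" "c \<subseteq> G" for S G
          using that by blast
        have "g ` (R `` {x}) \<subseteq> g ` W" using R_W by blast
        from *[OF this True] show ?thesis
          by (simp only: image_iff Bex_def Image_singleton_iff eq_commute[of "g _"])
      qed
      ultimately show ?thesis by simp
    next
      case False
      then have "g ` (R `` {x}) \<noteq> c" for x using R_W by blast
      then show ?thesis using definable_const[of False] by simp
    qed
  qed
qed

lemma discernible_Int:
  assumes "finite A" "A \<subseteq> L" shows "discernible (\<lambda>x. x \<inter> A)"
  using assms
proof (induction A rule: finite_induct)
  case empty
  then show ?case using discernible_of_definable[OF definable_const, of False]
    by (auto dest: discernible_comp[where h = "\<lambda>_. {}"])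
next
  case (insert \<phi> A)
  then have "discernible (\<lambda>x. (\<phi> \<in> x, x \<inter> A))"
    by (intro discernible_pair discernible_of_definable definable_mem) auto
  from discernible_comp[OF this, of "\<lambda>(b, B). if b then insert \<phi> B else B"]
  have "discernible (\<lambda>x. if \<phi> \<in> x then insert \<phi> (x \<inter> A) else x \<inter> A)" by simp
  moreover have "(if \<phi> \<in> x then insert \<phi> (x \<inter> A) else x \<inter> A) = x \<inter> insert \<phi> A" for x by auto
  ultimately show ?case by simp
qed

text \<open>The scheme \<open>G\<^sub>n\<close> read as a statement about disjoint definable sets: the formulas
  \<open>Q\<^sub>i\<close> built from defining formulas are again defining formulas.\<close>

lemma G_in:
  assumes x: "x \<in> W" "G_axioms n L \<subseteq> x"
    and P: "\<And>i. definable (P i)" and disj: "\<And>i j w. P i w \<Longrightarrow> P j w \<Longrightarrow> i = j"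
    and sees: "\<And>i. i \<le> n \<Longrightarrow> \<exists>y. (x, y) \<in> R \<and> P i y"
  shows "\<exists>z. (x, z) \<in> R \<and> (\<forall>i\<le>n. \<not> P i z \<or> (\<exists>w. (z, w) \<in> R \<and> \<not> P i w))"
proof -
  obtain \<phi> where \<phi>: "\<And>i. \<phi> i \<in> L" "\<And>i w. w \<in> W \<Longrightarrow> \<phi> i \<in> w \<longleftrightarrow> P i w"
    using P unfolding definable_def by metis
  have QL: "G_Q n \<phi> i \<in> L" for i using \<phi>(1) by (auto simp: G_Q_def)
  have Q: "G_Q n \<phi> i \<in> w \<longleftrightarrow> P i w" if "w \<in> W" for i w
  proof -
    have "G_Q n \<phi> i \<in> w \<longleftrightarrow> \<phi> i \<in> w \<and> (\<forall>j<Suc n. j \<noteq> i \<longrightarrow> \<phi> j \<notin> w)"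
      using \<phi>(1) that by (auto simp: G_Q_def image_subset_iff simp del: upt_Suc)
    then show ?thesis using \<phi>(2) that disj by metis
  qed
  let ?A = "Conj (map (\<lambda>i. Dia (G_Q n \<phi> i)) [0..<Suc n])"
  let ?C = "Conj (map (\<lambda>i. DiaS (Neg (G_Q n \<phi> i))) [0..<Suc n])"
  have L: "?A \<in> L" "?C \<in> L" using QL by auto
  have "Imp ?A (Dia ?C) \<in> x" using x(2) \<phi>(1) unfolding G_axioms_def by blast
  moreover have "?A \<in> x"
  proof -
    have "Dia (G_Q n \<phi> i) \<in> x" if "i < Suc n" for i
      unfolding Dia_in[OF x(1) QL] using sees[of i] that Q R_W by auto
    then show ?thesis using x QL by (subst Conj_in) (auto simp del: Neg_in)
  qed
  ultimately have "Dia ?C \<in> x" using Imp_in[OF x(1) L(1), of "Dia ?C"] L(2) by simp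
  then obtain z where z: "(x, z) \<in> R" "?C \<in> z" unfolding Dia_in[OF x(1) L(2)] by blast
  have zW: "z \<in> W" using z R_W by blast
  have "\<not> P i z \<or> (\<exists>w. (z, w) \<in> R \<and> \<not> P i w)" if "i \<le> n" for i
  proof -
    have "set (map (\<lambda>i. DiaS (Neg (G_Q n \<phi> i))) [0..<Suc n]) \<subseteq> z"
      using z(2) zW QL by (subst (asm) Conj_in) auto
    then have "DiaS (Neg (G_Q n \<phi> i)) \<in> z" using that
      by (auto simp: image_subset_iff simp del: upt_Suc)
    then have "Neg (G_Q n \<phi> i) \<in> z \<or> Dia (Neg (G_Q n \<phi> i)) \<in> z" using zW QL by auto
    moreover have "Neg (G_Q n \<phi> i) \<in> L" using QL by simp
    ultimately show ?thesis
      using Dia_in[OF zW] Q QL R_W zW Neg_in by metis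
  qed
  then show ?thesis using z by blast
qed

end

section \<open>Counting path components\<close>

text \<open>More than \<open>n\<close> components could be coloured with exactly the colours \<open>0, \<dots>, n\<close> by numbering them and
  giving all components from number \<open>n\<close> on the same colour. Working with colourings avoids any further
  mention of components.\<close>

lemma few_path_components:
  fixes F :: "'a frame"
  assumes fin: "finite (fst F)"
    and no_colouring: "\<And>g :: 'a \<Rightarrow> nat. (\<And>u v. (u, v) \<in> snd F \<Longrightarrow> g u = g v) \<Longrightarrow>
      g ` fst F = {..n} \<Longrightarrow> False"
    and sub: "snd F \<subseteq> fst F \<times> fst F"
  shows "finite (path_components F) \<and> card (path_components F) \<le> n"
proof
  show finC: "finite (path_components F)"
    unfolding path_components_def using fin by (rule finite_quotient) (auto simp: path_rel_def)
  show "card (path_components F) \<le> n"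
  proof (rule ccontr)
    assume big: "\<not> ?thesis"
    obtain e where e: "bij_betw e (path_components F) {0..<card (path_components F)}"
      using ex_bij_betw_finite_nat[OF finC] by blast
    define g where "g v = min n (e (path_rel F `` {v}))" for v
    have "sym ((snd F \<union> (snd F)\<inverse>)\<^sup>*)" by (intro sym_rtrancl sym_Un_converse)
    moreover have "trans ((snd F \<union> (snd F)\<inverse>)\<^sup>*)" by (rule trans_rtrancl)
    ultimately have eq: "path_rel F `` {u} = path_rel F `` {v}" if "(u, v) \<in> snd F" for u v
      using that sub unfolding path_rel_def
      by (auto dest: symD transD intro: r_into_rtrancl converse_rtrancl_into_rtrancl)
    show False
    proof (rule no_colouring[of g])
      show "g u = g v" if "(u, v) \<in> snd F" for u v using eq[OF that] by (simp add: g_def)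
      show "g ` fst F = {..n}"
      proof (intro subset_antisym subsetI)
        fix i assume "i \<in> {..n}"
        then have "i \<in> e ` path_components F" using e big by (auto simp: bij_betw_def)
        then obtain v where "v \<in> fst F" "i = e (path_rel F `` {v})"
          by (auto simp: path_components_def elim: quotientE)
        then have "v \<in> fst F" "g v = i" using \<open>i \<in> {..n}\<close> by (auto simp: g_def)
        then show "i \<in> g ` fst F" by blast
      qed (auto simp: g_def)
    qed
  qed
qed

section \<open>Clusters of worlds\<close>

fun parts :: "'v fm \<Rightarrow> 'v fm set" where
  "parts (Neg \<phi>) = {\<phi>}"
| "parts (And \<phi> \<psi>) = {\<phi>, \<psi>}"
| "parts (Box \<phi>) = {\<phi>}"
| "parts (Univ \<phi>) = {\<phi>}"
| "parts (Tangle \<Gamma>) = fset \<Gamma>"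
| "parts _ = {}"

locale tangle_filtration = tangle_worlds L W R
  for L :: "'v fm set" and W :: "'v fm set set" and R :: "('v fm set \<times> 'v fm set) set" +
  fixes \<Phi> :: "'v fm set"
  assumes finite_\<Phi> [simp]: "finite \<Phi>"
    and \<Phi>_L: "\<phi> \<in> \<Phi> \<Longrightarrow> \<phi> \<in> L"
    and \<Phi>_parts: "\<phi> \<in> \<Phi> \<Longrightarrow> parts \<phi> \<subseteq> \<Phi>"
begin

lemma \<Phi>_Neg: "Neg \<phi> \<in> \<Phi> \<Longrightarrow> \<phi> \<in> \<Phi>"
  and \<Phi>_And: "And \<phi> \<psi> \<in> \<Phi> \<Longrightarrow> \<phi> \<in> \<Phi> \<and> \<psi> \<in> \<Phi>"
  and \<Phi>_Box: "Box \<phi> \<in> \<Phi> \<Longrightarrow> \<phi> \<in> \<Phi>"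
  and \<Phi>_Univ: "Univ \<phi> \<in> \<Phi> \<Longrightarrow> \<phi> \<in> \<Phi>"
  and \<Phi>_Tangle: "Tangle \<Gamma> \<in> \<Phi> \<Longrightarrow> fset \<Gamma> \<subseteq> \<Phi>"
  by (force dest: \<Phi>_parts)+

definition dead :: "'v fm set \<Rightarrow> bool" where
  "dead x \<longleftrightarrow> R `` {x} = {}"

text \<open>What a world still has to realise at later worlds: a counterexample for each failing box, and
  the members of each tangle.\<close>

definition demands :: "'v fm set \<Rightarrow> 'v fm set" where
  "demands x = {\<psi> \<in> \<Phi>. (\<exists>\<phi>. \<psi> = Box \<phi> \<and> \<psi> \<notin> x) \<or> (\<exists>\<Gamma>. \<psi> = Tangle \<Gamma> \<and> \<psi> \<in> x)}"

text \<open>The last summand tells whether a world sees a dead end or a world with fewer demands. It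
  ensures that of two worlds with the same \<open>level\<close> either both or none see a world of smaller
  rank (\<open>below_empty_iff\<close>).\<close>

definition rk :: "'v fm set \<Rightarrow> nat" where
  "rk x = (if dead x then 0
    else 1 + 2 * card (demands x)
      + (if \<exists>y. (x, y) \<in> R \<and> (dead y \<or> demands y \<noteq> demands x) then 1 else 0))"

text \<open>Labels are coded by numbers so that the points of the frame are numbers; this also gives a
  uniform type to the values of the recursive function \<open>cluster\<close>.\<close>

definition code :: "'v fm set \<Rightarrow> nat" where
  "code = (SOME c. inj_on c (Pow \<Phi>))"

text \<open>At a dead end all formulas of \<open>\<Phi>\<close> are recorded: dead ends in one cluster must coincide
  as points, since no successor connects them.\<close>

definition level :: "'v fm set \<Rightarrow> nat" where
  "level x = prod_encode (rk x, code (if dead x then x \<inter> \<Phi> else demands x))"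

function cluster :: "'v fm set \<Rightarrow> nat" where
  "cluster x = prod_encode (level x, set_encode (cluster ` {y. (x, y) \<in> R \<and> rk y < rk x}))"
  by auto
termination by (relation "measure rk") auto

declare cluster.simps [simp del]

definition below :: "'v fm set \<Rightarrow> nat set" where
  "below x = cluster ` {y. (x, y) \<in> R \<and> rk y < rk x}"

definition node :: "'v fm set \<Rightarrow> nat" where
  "node x = prod_encode (code (x \<inter> \<Phi>), cluster x)"

lemma cluster_eq: "cluster x = prod_encode (level x, set_encode (below x))"
  by (subst cluster.simps) (simp add: below_def)

lemma demands_subset: "demands x \<subseteq> \<Phi>"
  by (auto simp: demands_def)

lemma demands_Box: "Box \<phi> \<in> \<Phi> \<Longrightarrow> Box \<phi> \<in> demands x \<longleftrightarrow> Box \<phi> \<notin> x"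
  and demands_Tangle: "Tangle \<Gamma> \<in> \<Phi> \<Longrightarrow> Tangle \<Gamma> \<in> demands x \<longleftrightarrow> Tangle \<Gamma> \<in> x"
  by (auto simp: demands_def)

lemma finite_demands [simp]: "finite (demands x)"
  using demands_subset finite_\<Phi> by (rule finite_subset)

lemma code_inj: "inj_on code (Pow \<Phi>)"
proof -
  have "\<exists>c :: 'v fm set \<Rightarrow> nat. inj_on c (Pow \<Phi>)"
    using finite_imp_inj_to_nat_seg[of "Pow \<Phi>"] by auto
  then show ?thesis unfolding code_def by (rule someI_ex)
qed

lemma code_eq [simp]: "A \<subseteq> \<Phi> \<Longrightarrow> B \<subseteq> \<Phi> \<Longrightarrow> code A = code B \<longleftrightarrow> A = B"
  using code_inj by (auto simp: inj_on_def)

lemma level_eqD: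
  assumes "level x = level y"
  shows "rk x = rk y" "dead x = dead y" "demands x = demands y" "dead x \<Longrightarrow> x \<inter> \<Phi> = y \<inter> \<Phi>"
proof -
  show rk: "rk x = rk y" using assms by (simp add: level_def)
  show dead: "dead x = dead y" using rk by (simp add: rk_def split: if_splits)
  show "x \<inter> \<Phi> = y \<inter> \<Phi>" if "dead x"
    using that assms dead by (simp add: level_def)
  then have "x \<inter> \<Phi> = y \<inter> \<Phi>" if "dead x" using that by simp
  then show "demands x = demands y"
    using assms dead demands_subset by (cases "dead x") (auto simp: level_def demands_def)
qed

lemma demands_mono:
  assumes "(x, y) \<in> R" shows "demands y \<subseteq> demands x"
proof
  fix \<psi> assume \<psi>: "\<psi> \<in> demands y"
  have x: "x \<in> W" "y \<in> W" using assms R_W by auto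
  show "\<psi> \<in> demands x"
  proof (cases "\<exists>\<phi>. \<psi> = Box \<phi>")
    case True
    then obtain \<phi> where \<phi>: "\<psi> = Box \<phi>" "Box \<phi> \<in> \<Phi>" "Box \<phi> \<notin> y" using \<psi> by (auto simp: demands_def)
    then have "\<phi> \<in> L" using \<Phi>_L by fastforce
    then have "Box \<phi> \<notin> x" using \<phi> x assms R_trans Box_in by blast
    then show ?thesis using \<phi> by (simp add: demands_def)
  next
    case False
    then obtain \<Gamma> where "\<psi> = Tangle \<Gamma>" "Tangle \<Gamma> \<in> \<Phi>" "Tangle \<Gamma> \<in> y"
      using \<psi> by (auto simp: demands_def)
    then show ?thesis using Tangle_back[OF assms] \<Phi>_L by (auto simp: demands_def)
  qed
qed

lemma level_step:
  assumes "(x, y) \<in> R"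
  shows "level y = level x \<or> rk y < rk x"
proof -
  have nd: "\<not> dead x" using assms by (auto simp: dead_def)
  show ?thesis
  proof (cases "dead y")
    case True
    then show ?thesis using nd by (simp add: rk_def)
  next
    case False
    show ?thesis
    proof (cases "demands y = demands x")
      case True
      have "\<exists>z. (x, z) \<in> R \<and> (dead z \<or> demands z \<noteq> demands x)"
        if "(y, z) \<in> R" "dead z \<or> demands z \<noteq> demands y" for z
        using that True R_trans[OF assms that(1)] by auto
      then show ?thesis using nd \<open>\<not> dead y\<close> True by (auto simp: level_def rk_def)
    next
      case False
      then have "card (demands y) < card (demands x)"
        using demands_mono[OF assms] by (intro psubset_card_mono) auto
      then show ?thesis using nd \<open>\<not> dead y\<close> by (simp add: rk_def)
    qed
  qed
qed

lemma discernible_demands: "discernible demands"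
proof -
  have "discernible (\<lambda>x. x \<inter> \<Phi>)" using \<Phi>_L by (intro discernible_Int) auto
  from discernible_comp[OF this, of "\<lambda>A. {\<psi> \<in> \<Phi>. (\<exists>\<phi>. \<psi> = Box \<phi> \<and> \<psi> \<notin> A) \<or> (\<exists>\<Gamma>. \<psi> = Tangle \<Gamma> \<and> \<psi> \<in> A)}"]
  show ?thesis by (rule back_subst[of discernible]) (auto simp: demands_def fun_eq_iff)
qed

lemma discernible_dead: "discernible dead"
proof -
  have "definable (\<lambda>x. \<not> (\<exists>y. (x, y) \<in> R \<and> True))"
    by (intro definable_not definable_dia definable_const)
  then have "definable dead" by (rule definable_cong[rotated]) (auto simp: dead_def)
  then show ?thesis by (rule discernible_of_definable)
qed

lemma discernible_level: "discernible (\<lambda>x. (rk x, level x))"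
proof -
  let ?d = "\<lambda>x. (dead x, demands x)"
  let ?r = "\<lambda>((d, A), S). if d then 0 else 1 + 2 * card A
    + (if \<exists>(d', A') \<in> S. d' \<or> A' \<noteq> A then 1 else 0)"
  have d: "discernible ?d" by (intro discernible_pair discernible_dead discernible_demands)
  have "discernible (\<lambda>x. ?r (?d x, ?d ` (R `` {x})))"
    by (intro discernible_comp[where h = ?r] discernible_pair[OF d] discernible_successors d)
  moreover have "?r (?d x, ?d ` (R `` {x})) = rk x" for x
    by (auto simp: rk_def)
  ultimately have rk: "discernible rk" by simp
  have "discernible (\<lambda>x. x \<inter> \<Phi>)" using \<Phi>_L by (intro discernible_Int) auto
  then have *: "discernible (\<lambda>x. (rk x, ?d x, x \<inter> \<Phi>))"
    by (intro discernible_pair rk discernible_dead discernible_demands)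
  have "discernible (\<lambda>x. (\<lambda>(r, (d, A), B). (r, prod_encode (r, code (if d then B else A))))
    (rk x, ?d x, x \<inter> \<Phi>))"
    using discernible_comp[OF *] .
  then show ?thesis by (simp add: level_def)
qed

text \<open>Truncating \<open>cluster\<close> at rank \<open>k\<close> turns its recursion into a finite iteration of the closure
  operations for discernible maps.\<close>

lemma discernible_cluster: "discernible cluster"
proof -
  have trunc: "discernible (\<lambda>x. if rk x < k then cluster x else 0)" for k
  proof (induction k)
    case 0
    then show ?case using discernible_comp[OF discernible_dead, of "\<lambda>_. 0::nat"] by simp
  next
    case (Suc k)
    let ?p = "\<lambda>x. (rk x, if rk x < k then cluster x else 0)"
    let ?h = "\<lambda>((r, l), S). if r < Suc k
      then prod_encode (l, set_encode (snd ` {p \<in> S. fst p < r})) else 0"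
    have rk: "discernible rk" using discernible_comp[OF discernible_level, of fst] by simp
    have "discernible (\<lambda>x. ?h ((rk x, level x), ?p ` (R `` {x})))"
      by (intro discernible_comp[where h = ?h] discernible_pair[OF discernible_level]
          discernible_successors discernible_pair[OF rk] Suc.IH)
    moreover have "?h ((rk x, level x), ?p ` (R `` {x})) = (if rk x < Suc k then cluster x else 0)"
      for x
    proof -
      have "snd ` {p \<in> ?p ` (R `` {x}). fst p < rk x} = below x" if "rk x < Suc k"
        using that by (force simp: below_def image_iff)
      then show ?thesis by (simp add: cluster_eq)
    qed
    ultimately show ?case by simp
  qed
  have "finite (rk ` W)"
    using discernible_comp[OF discernible_level, of fst] by (simp add: discernible_def)
  then obtain k where "rk x < k" if "x \<in> W" for x
    by (metis finite_nat_set_iff_bounded imageI)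
  then show ?thesis by (intro discernible_cong[OF _ trunc[of k]]) simp
qed

lemma discernible_node: "discernible node"
proof -
  have "discernible (\<lambda>x. x \<inter> \<Phi>)" using \<Phi>_L by (intro discernible_Int) auto
  then have "discernible (\<lambda>x. (x \<inter> \<Phi>, cluster x))" by (intro discernible_pair discernible_cluster)
  from discernible_comp[OF this, of "\<lambda>(A, c). prod_encode (code A, c)"]
  have "discernible (\<lambda>x. prod_encode (code (x \<inter> \<Phi>), cluster x))" by simp
  then show ?thesis by (rule discernible_cong[rotated]) (simp add: node_def)
qed

lemma finite_clusters: "finite (cluster ` W)" and finite_nodes: "finite (node ` W)"
  using discernible_cluster discernible_node by (auto simp: discernible_def)

lemma below_subset: "below x \<subseteq> cluster ` W"
  using R_W by (auto simp: below_def)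

lemma finite_below [simp]: "finite (below x)"
  using below_subset finite_clusters by (rule finite_subset)

lemma cluster_eq_iff: "cluster x = cluster y \<longleftrightarrow> level x = level y \<and> below x = below y"
  by (simp add: cluster_eq set_encode_eq)

lemma cluster_eqD:
  assumes "cluster x = cluster y"
  shows "level x = level y" "below x = below y" "rk x = rk y" "dead x = dead y"
    "demands x = demands y" "dead x \<Longrightarrow> x \<inter> \<Phi> = y \<inter> \<Phi>"
proof -
  show l: "level x = level y" and "below x = below y" using assms by (simp_all add: cluster_eq_iff)
  show "rk x = rk y" "dead x = dead y" "demands x = demands y" "dead x \<Longrightarrow> x \<inter> \<Phi> = y \<inter> \<Phi>"
    using level_eqD[OF l] by auto
qed

lemma node_eq_iff: "node x = node y \<longleftrightarrow> x \<inter> \<Phi> = y \<inter> \<Phi> \<and> cluster x = cluster y"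
  by (simp add: node_def)

text \<open>A single number that drops along \<open>R\<close> except inside a cluster; the factor makes
  the rank outweigh the number of clusters in sight.\<close>

definition height :: "'v fm set \<Rightarrow> nat" where
  "height x = rk x * Suc (card (cluster ` W)) + card (below x)"

lemma height_cluster: "cluster x = cluster y \<Longrightarrow> height x = height y"
  using cluster_eqD(2,3)[of x y] by (simp add: height_def)

lemma below_mono:
  assumes "(x, y) \<in> R" "rk x = rk y" shows "below y \<subseteq> below x"
  using assms R_trans by (auto simp: below_def)

lemma height_step:
  assumes "(x, y) \<in> R" shows "cluster y = cluster x \<or> height y < height x"
proof (cases "rk y < rk x")
  case True
  have "card (below y) \<le> card (cluster ` W)"
    by (intro card_mono finite_clusters below_subset)
  moreover have "Suc (rk y) * Suc (card (cluster ` W)) \<le> rk x * Suc (card (cluster ` W))"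
    using True by (intro mult_le_mono1) auto
  ultimately show ?thesis by (simp add: height_def)
next
  case False
  then have lev: "level y = level x" using level_step[OF assms] by simp
  then have rk: "rk y = rk x" by (rule level_eqD)
  then have "below y \<subseteq> below x" using below_mono assms by simp
  then show ?thesis
    using lev rk psubset_card_mono[of "below x" "below y"]
    by (auto simp: cluster_eq_iff height_def)
qed

section \<open>The finite frame\<close>

definition rep :: "nat \<Rightarrow> 'v fm set" where
  "rep c = arg_min (\<lambda>y. card (node ` {z. (y, z) \<in> R \<and> cluster z = c})) (\<lambda>y. y \<in> W \<and> cluster y = c)"

lemma rep:
  assumes "x \<in> W" shows "rep (cluster x) \<in> W" "cluster (rep (cluster x)) = cluster x"
  using arg_min_natI[of "\<lambda>y. y \<in> W \<and> cluster y = cluster x" x] assms by (auto simp: rep_def)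

lemma rep_least:
  assumes "x \<in> W"
  shows "card (node ` {z. (rep (cluster x), z) \<in> R \<and> cluster z = cluster x})
    \<le> card (node ` {z. (x, z) \<in> R \<and> cluster z = cluster x})"
  using arg_min_nat_le[of "\<lambda>y. y \<in> W \<and> cluster y = cluster x" x
      "\<lambda>y. card (node ` {z. (y, z) \<in> R \<and> cluster z = cluster x})"] assms
  by (simp add: rep_def)

text \<open>By minimality every successor of the representative inside the cluster sees the same points
  of the cluster. If these points realised all members of \<open>\<Gamma>\<close>, the formula defining the cluster
  would satisfy the premise of \<open>Ind\<close> at the representative, and the tangle would hold there.\<close>

lemma critical:
  assumes x: "x \<in> W" and \<Gamma>: "Tangle \<Gamma> \<in> L" "Tangle \<Gamma> \<notin> rep (cluster x)" "fset \<Gamma> \<subseteq> \<Phi>"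
  shows "\<exists>\<gamma>\<in>fset \<Gamma>. \<forall>z. (rep (cluster x), z) \<in> R \<and> cluster z = cluster x \<longrightarrow> \<gamma> \<notin> z"
proof (rule ccontr)
  assume neg: "\<not> ?thesis"
  define r where "r = rep (cluster x)"
  define N where "N y = node ` {z. (y, z) \<in> R \<and> cluster z = cluster x}" for y
  obtain \<chi> where \<chi>: "\<chi> \<in> L" "\<forall>y\<in>W. \<chi> \<in> y \<longleftrightarrow> cluster y = cluster x"
    using discernible_cluster by (auto simp: discernible_def definable_def)
  have r: "r \<in> W" "cluster r = cluster x" using rep[OF x] by (auto simp: r_def)
  have "Tangle \<Gamma> \<in> r"
  proof (rule Ind_in[OF r(1) \<Gamma>(1) \<chi>(1)])
    show "\<chi> \<in> r" using \<chi> r by simp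
    fix y \<gamma> assume y: "y = r \<or> (r, y) \<in> R" "\<chi> \<in> y" and \<gamma>: "\<gamma> \<in> fset \<Gamma>"
    have yW: "y \<in> W" using y r R_W by auto
    then have cy: "cluster y = cluster x" using \<chi> y by simp
    have "N y \<subseteq> N r" using y R_trans by (auto simp: N_def)
    moreover have "finite (N r)"
      using finite_nodes R_W by (rule_tac finite_subset[of _ "node ` W"]) (auto simp: N_def)
    moreover have "card (N r) \<le> card (N y)" using rep_least[OF yW] cy by (simp add: N_def r_def)
    ultimately have "N y = N r" by (meson card_seteq)
    moreover obtain z where z: "(r, z) \<in> R" "cluster z = cluster x" "\<gamma> \<in> z"
      using neg \<gamma> by (auto simp: r_def)
    ultimately have "node z \<in> N y" by (auto simp: N_def)
    then obtain z' where z': "(y, z') \<in> R" "cluster z' = cluster x" "node z' = node z"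
      by (auto simp: N_def)
    then have "\<gamma> \<in> z'" using z \<gamma> \<Gamma> by (auto simp: node_eq_iff)
    then show "\<exists>z. (y, z) \<in> R \<and> \<gamma> \<in> z \<and> \<chi> \<in> z" using z' \<chi> R_W by blast
  qed
  then show False using \<Gamma> by (simp add: r_def)
qed

definition steps :: "(nat \<times> nat) set" where
  "steps = {(node x, node z) | x z. x \<in> W \<and> (rep (cluster x), z) \<in> R}"

definition finite_frame :: "nat frame" where
  "finite_frame = (node ` W, steps\<^sup>+)"

definition valuation :: "'v \<Rightarrow> nat set" where
  "valuation p = {node x | x. x \<in> W \<and> Atom p \<in> \<Phi> \<and> Atom p \<in> x}"

lemma steps_iff: "x \<in> W \<Longrightarrow> (node x, v) \<in> steps \<longleftrightarrow> (\<exists>z. (rep (cluster x), z) \<in> R \<and> v = node z)"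
  by (fastforce simp: steps_def node_eq_iff)

lemma steps_W: "steps \<subseteq> node ` W \<times> node ` W"
  using R_W by (auto simp: steps_def)

lemma trancl_steps_W: "steps\<^sup>+ \<subseteq> node ` W \<times> node ` W"
  using steps_W by (rule trancl_subset_Sigma)

lemma step_rep: "x \<in> W \<Longrightarrow> (rep (cluster x), z) \<in> R \<Longrightarrow> (node x, node z) \<in> steps\<^sup>+"
  using steps_iff by blast

text \<open>All points of a cluster copy the successors of its representative, which has the same demands;
  so whatever passes from a world to its successors also passes along paths of the frame, and a
  path can return to its first cluster only at points that the representative sees there.\<close>

lemma path_descends:
  assumes x: "x \<in> W" and "(node x, v) \<in> steps\<^sup>+"
  shows "\<exists>z\<in>W. v = node z \<and> demands z \<subseteq> demands x \<and>
    (cluster z = cluster x \<and> (rep (cluster x), z) \<in> R \<or> height z < height x) \<and>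
    (\<forall>\<phi>. Box \<phi> \<in> \<Phi> \<longrightarrow> Box \<phi> \<in> x \<longrightarrow> \<phi> \<in> z)"
  using assms(2)
proof (induction rule: trancl_induct)
  have single: "demands z \<subseteq> demands x \<and>
    (cluster z = cluster x \<and> (rep (cluster x), z) \<in> R \<or> height z < height x) \<and>
    (\<forall>\<phi>. Box \<phi> \<in> \<Phi> \<longrightarrow> Box \<phi> \<in> x \<longrightarrow> \<phi> \<in> z)" if "x \<in> W" "(rep (cluster x), z) \<in> R" for x z
  proof -
    note r = rep[OF that(1)]
    have d: "demands (rep (cluster x)) = demands x"
      by (rule cluster_eqD(5)[OF r(2)])
    have "\<phi> \<in> z" if "Box \<phi> \<in> \<Phi>" "Box \<phi> \<in> x" for \<phi>
    proof -
      have "Box \<phi> \<in> rep (cluster x)" using d that demands_Box by blast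
      moreover have "\<phi> \<in> L" using \<Phi>_L that by fastforce
      ultimately show ?thesis using Box_in r \<open>(rep (cluster x), z) \<in> R\<close> by blast
    qed
    then show ?thesis
      using demands_mono[OF that(2)] height_step[OF that(2)] d height_cluster[OF r(2)] r(2) that(2)
      by auto
  qed
  {
    case (base v)
    then show ?case using single[OF x] steps_iff[OF x] R_W by blast
  next
    case (step v w)
    then obtain z where z: "z \<in> W" "v = node z" "demands z \<subseteq> demands x"
      "cluster z = cluster x \<and> (rep (cluster x), z) \<in> R \<or> height z < height x"
      by blast
    obtain y where y: "(rep (cluster z), y) \<in> R" "w = node y"
      using step.hyps(2) z(1,2) steps_iff[OF z(1), of w] by auto
    note s = single[OF z(1) y(1)]
    have "\<phi> \<in> y" if "Box \<phi> \<in> \<Phi>" "Box \<phi> \<in> x" for \<phi>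
    proof -
      have "Box \<phi> \<notin> demands z" using that z(3) demands_Box by blast
      then show ?thesis using s that demands_Box by blast
    qed
    moreover have "cluster y = cluster x \<and> (rep (cluster x), y) \<in> R \<or> height y < height x"
      using z(4) s y(1) height_cluster[of z x] height_cluster[of y z] by auto
    moreover have "demands y \<subseteq> demands x" using s z by blast
    ultimately show ?case using y R_W by blast
  }
qed

text \<open>A path satisfying a tangle ends in one cluster, where \<open>critical\<close> forces the tangle to hold.
  Conversely, among the worlds reachable with the tangle true, take one of least height: there
  \<open>Fix\<close> cannot lead out of the cluster, so the representative sees all members of \<open>\<Gamma>\<close> inside
  it, and the points so found are mutually related and can be visited cyclically.\<close>

lemma sat_Tangle:
  assumes "Tangle \<Gamma> \<in> \<Phi>" "x \<in> W"
    and IH: "\<And>\<gamma> x. \<gamma> \<in> fset \<Gamma> \<Longrightarrow> x \<in> W \<Longrightarrow> sat finite_frame valuation (node x) \<gamma> \<longleftrightarrow> \<gamma> \<in> x"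
  shows "sat finite_frame valuation (node x) (Tangle \<Gamma>) \<longleftrightarrow> Tangle \<Gamma> \<in> x"
proof
  have \<Gamma>\<Phi>: "fset \<Gamma> \<subseteq> \<Phi>" and \<Gamma>L: "Tangle \<Gamma> \<in> L" using assms \<Phi>_Tangle \<Phi>_L by auto
  have same: "Tangle \<Gamma> \<in> z" if "Tangle \<Gamma> \<in> y" "cluster y = cluster z" for y z
  proof -
    have "Tangle \<Gamma> \<in> demands y \<longleftrightarrow> Tangle \<Gamma> \<in> demands z"
      using cluster_eqD(5)[OF that(2)] by simp
    then show ?thesis using demands_Tangle[OF assms(1)] that(1) by blast
  qed
  {
    assume "sat finite_frame valuation (node x) (Tangle \<Gamma>)"
    then obtain s where s: "s 0 = node x" "\<And>i. (s i, s (Suc i)) \<in> steps\<^sup>+"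
      "\<And>\<gamma>. \<gamma> \<in> fset \<Gamma> \<Longrightarrow> infinite {i. sat finite_frame valuation (s i) \<gamma>}"
      by (auto simp: finite_frame_def)
    have "s i \<in> node ` W" for i
      using subsetD[OF trancl_steps_W s(2)[of i]] by (rule SigmaD1)
    then obtain w where w: "\<And>i. w i \<in> W" "\<And>i. s i = node (w i)" 
    proof -
      from \<open>\<And>i. s i \<in> node ` W\<close> have "\<forall>i. \<exists>x. x \<in> W \<and> s i = node x" by blast
      then show thesis using that by (metis (no_types))
    qed
    have tr: "(s i, s j) \<in> steps\<^sup>+" if "i < j" for i j
      using that by (induction rule: less_Suc_induct) (auto intro: s trancl_trans)
    obtain i where "height (w i) = (LEAST m. \<exists>i. m = height (w i))"
      using LeastI_ex[of "\<lambda>m. \<exists>i. m = height (w i)"] by metis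
    then have i: "height (w i) \<le> height (w j)" for j by (metis (mono_tags, lifting) Least_le)
    show "Tangle \<Gamma> \<in> x"
    proof (rule ccontr)
      assume "Tangle \<Gamma> \<notin> x"
      moreover have "i = 0 \<or> (node x, node (w i)) \<in> steps\<^sup>+" using tr[of 0 i] s w by auto
      ultimately have "Tangle \<Gamma> \<notin> w i"
      proof (elim disjE)
        assume "Tangle \<Gamma> \<notin> x" "i = 0"
        then show ?thesis using s(1) w(2)[of 0] assms by (auto simp: node_eq_iff)
      next
        assume "Tangle \<Gamma> \<notin> x" "(node x, node (w i)) \<in> steps\<^sup>+"
        then obtain z where z: "node (w i) = node z" "demands z \<subseteq> demands x"
          using path_descends[OF assms(2)] by blast
        have "Tangle \<Gamma> \<notin> demands x" using \<open>Tangle \<Gamma> \<notin> x\<close> assms(1) demands_Tangle by blast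
        with z(2) have "Tangle \<Gamma> \<notin> demands z" by (rule contra_subsetD)
        then have Tz: "Tangle \<Gamma> \<notin> z" using assms(1) demands_Tangle by blast
        have "cluster (w i) = cluster z" using z(1) by (simp only: node_eq_iff)
        then show ?thesis using same[of "w i" z] Tz by blast
      qed
      then have "Tangle \<Gamma> \<notin> rep (cluster (w i))" using same[OF _ rep(2)[OF w(1)]] by blast
      then obtain \<gamma> where \<gamma>: "\<gamma> \<in> fset \<Gamma>"
        "\<And>z. (rep (cluster (w i)), z) \<in> R \<Longrightarrow> cluster z = cluster (w i) \<Longrightarrow> \<gamma> \<notin> z"
        using critical[OF w(1) \<Gamma>L _ \<Gamma>\<Phi>] by blast
      have "\<not> sat finite_frame valuation (s j) \<gamma>" if ij: "i < j" for j
      proof -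
        obtain z where z: "z \<in> W" "node (w j) = node z"
          "cluster z = cluster (w i) \<and> (rep (cluster (w i)), z) \<in> R \<or> height z < height (w i)"
          using path_descends[OF w(1)[of i], of "s j"] tr[OF ij] w by (auto simp: w)
        moreover have "height z = height (w j)"
          using z(2) by (intro height_cluster) (simp add: node_eq_iff)
        ultimately have "\<gamma> \<notin> z" using i[of j] \<gamma> by auto
        then show ?thesis using z w(2)[of j] IH[OF \<gamma>(1) z(1)] by simp
      qed
      then have "{j. sat finite_frame valuation (s j) \<gamma>} \<subseteq> {..i}" by (auto simp: not_less[symmetric])
      then show False using s(3)[OF \<gamma>(1)] finite_subset by blast
    qed
  next
    assume T: "Tangle \<Gamma> \<in> x"
    define P where "P y \<longleftrightarrow> y \<in> W \<and> Tangle \<Gamma> \<in> y \<and> (y = x \<or> (node x, node y) \<in> steps\<^sup>+)" for y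
    have "P x" using T assms by (simp add: P_def)
    then obtain y where y: "P y" "\<And>z. P z \<Longrightarrow> height y \<le> height z"
      using ex_has_least_nat[of P x height] by blast
    have yW: "y \<in> W" and Ty: "Tangle \<Gamma> \<in> y" using y by (auto simp: P_def)
    let ?r = "rep (cluster y)"
    have r: "?r \<in> W" "cluster ?r = cluster y" using rep[OF yW] by auto
    have "Tangle \<Gamma> \<in> ?r" using same[OF Ty r(2)[symmetric]] .
    have wit: "\<exists>z. (?r, z) \<in> R \<and> cluster z = cluster y \<and> \<gamma> \<in> z" if \<gamma>: "\<gamma> \<in> fset \<Gamma>" for \<gamma>
    proof -
      obtain z where z: "(?r, z) \<in> R" "\<gamma> \<in> z" "Tangle \<Gamma> \<in> z"
        using Fix_in[OF r(1) \<Gamma>L \<open>Tangle \<Gamma> \<in> ?r\<close> \<gamma>] by blast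
      have "P z" using z y(1) step_rep[OF yW z(1)] R_W unfolding P_def
        by (meson trancl_trans)
      then have "height y \<le> height z" using y by blast
      then have "cluster z = cluster y"
        using height_step[OF z(1)] height_cluster[OF r(2)] r(2) by auto
      then show ?thesis using z by blast
    qed
    obtain g where g: "g \<in> fset \<Gamma>" using Tangle_L[OF \<Gamma>L] by fastforce
    obtain gs where gs: "set gs = fset \<Gamma>" using finite_list[of "fset \<Gamma>"] by auto
    then have len: "length gs > 0" using g by auto
    \<comment> \<open>a cyclic path through one witness for each member of the tangle\<close>
    define z where "z \<gamma> = (SOME z. (?r, z) \<in> R \<and> cluster z = cluster y \<and> \<gamma> \<in> z)" for \<gamma>
    have z: "(?r, z \<gamma>) \<in> R \<and> cluster (z \<gamma>) = cluster y \<and> \<gamma> \<in> z \<gamma>" if "\<gamma> \<in> fset \<Gamma>" for \<gamma>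
      unfolding z_def using wit[OF that] by (rule someI_ex)
    define w where "w i = z (gs ! (i mod length gs))" for i
    have gsi: "gs ! (i mod length gs) \<in> fset \<Gamma>" for i
      using len gs nth_mem[of "i mod length gs" gs] by simp
    have w: "(?r, w i) \<in> R" "cluster (w i) = cluster y" "w i \<in> W" for i
      using z[OF gsi[of i]] R_W by (auto simp: w_def)
    define s where "s i = (case i of 0 \<Rightarrow> node x | Suc j \<Rightarrow> node (w j))" for i
    have "(node x, node (w 0)) \<in> steps\<^sup>+"
    proof (cases "y = x")
      case True
      then show ?thesis using step_rep[OF yW w(1)[of 0]] by simp
    next
      case False
      then show ?thesis
        using y(1) step_rep[OF yW w(1)[of 0]] unfolding P_def by (blast intro: trancl_trans)
    qed
    moreover have "(node (w i), node (w (Suc i))) \<in> steps\<^sup>+" for i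
      using step_rep[OF w(3)[of i], of "w (Suc i)"] w by simp
    ultimately have "\<forall>i. (s i, s (Suc i)) \<in> steps\<^sup>+"
      by (auto simp: s_def split: nat.splits)
    moreover have "infinite {i. sat finite_frame valuation (s i) \<gamma>}" if \<gamma>: "\<gamma> \<in> fset \<Gamma>" for \<gamma>
    proof -
      obtain k where k: "k < length gs" "gs ! k = \<gamma>" using \<gamma> gs by (metis in_set_conv_nth)
      have "sat finite_frame valuation (s (Suc (k + length gs * m))) \<gamma>" for m
      proof -
        have "w (k + length gs * m) = z \<gamma>" using k by (simp add: w_def)
        then show ?thesis using IH[OF \<gamma> w(3), of "k + length gs * m"] z[OF \<gamma>] by (simp add: s_def)
      qed
      then have "range (\<lambda>m. Suc (k + length gs * m)) \<subseteq> {i. sat finite_frame valuation (s i) \<gamma>}"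
        by auto
      moreover have "inj (\<lambda>m. Suc (k + length gs * m))" using len by (auto intro!: injI)
      ultimately show ?thesis
        using finite_imageD infinite_UNIV_nat finite_subset by blast
    qed
    moreover have "s 0 = node x" by (simp add: s_def)
    ultimately show "sat finite_frame valuation (node x) (Tangle \<Gamma>)"
      by (auto simp: finite_frame_def)
  }
qed

lemma truth:
  "\<phi> \<in> \<Phi> \<Longrightarrow> x \<in> W \<Longrightarrow> sat finite_frame valuation (node x) \<phi> \<longleftrightarrow> \<phi> \<in> x"
proof (induction \<phi> arbitrary: x)
  case (Atom p)
  then show ?case by (auto simp: valuation_def node_eq_iff)
next
  case Top
  then show ?case by simp
next
  case (Neg \<phi>)
  moreover have "\<phi> \<in> \<Phi>" "\<phi> \<in> L" using Neg.prems \<Phi>_Neg \<Phi>_L by blast+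
  ultimately show ?case by simp
next
  case (And \<phi> \<psi>)
  moreover have "\<phi> \<in> \<Phi>" "\<phi> \<in> L" "\<psi> \<in> \<Phi>" "\<psi> \<in> L" using And.prems \<Phi>_And \<Phi>_L by blast+
  ultimately show ?case by simp
next
  case (Box \<phi>)
  have \<phi>: "\<phi> \<in> \<Phi>" "\<phi> \<in> L" using Box.prems \<Phi>_Box \<Phi>_L by blast+
  note r = rep[OF Box.prems(2)]
  show ?case
  proof
    assume "Box \<phi> \<in> x"
    then have "\<exists>z\<in>W. v = node z \<and> \<phi> \<in> z" if "(node x, v) \<in> steps\<^sup>+" for v
      using path_descends[OF Box.prems(2) that] Box.prems by blast
    then show "sat finite_frame valuation (node x) (Box \<phi>)"
      using Box.IH \<phi> by (fastforce simp: finite_frame_def)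
  next
    assume S: "sat finite_frame valuation (node x) (Box \<phi>)"
    have "demands (rep (cluster x)) = demands x"
      by (rule cluster_eqD(5)[OF r(2)])
    then have "Box \<phi> \<in> rep (cluster x) \<longleftrightarrow> Box \<phi> \<in> x"
      using demands_Box[OF Box.prems(1)] by blast
    moreover have "\<phi> \<in> z" if "(rep (cluster x), z) \<in> R" for z
      using S step_rep[OF Box.prems(2) that] Box.IH \<phi> R_W that by (auto simp: finite_frame_def)
    ultimately show "Box \<phi> \<in> x" using Box_in[OF r(1) \<phi>(2)] by blast
  qed
next
  case (Univ \<phi>)
  moreover have "\<phi> \<in> \<Phi>" using Univ.prems \<Phi>_Univ by blast
  ultimately show ?case using Univ_in \<Phi>_L by (simp add: finite_frame_def)
next
  case (Tangle \<Gamma>)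
  then show ?case using \<Phi>_Tangle by (intro sat_Tangle) blast+
qed

section \<open>Connectedness of the finite frame\<close>

lemma below_empty_iff:
  assumes "\<not> dead x"
  shows "below x = {} \<longleftrightarrow> rk x = 1 + 2 * card (demands x)"
proof
  assume "below x = {}"
  then have lev: "level z = level x" if "(x, z) \<in> R" for z
    using that level_step[OF that] by (auto simp: below_def)
  have "\<not> (dead z \<or> demands z \<noteq> demands x)" if "(x, z) \<in> R" for z
    using level_eqD(2,3)[OF lev[OF that]] assms by simp
  then show "rk x = 1 + 2 * card (demands x)" using assms by (auto simp: rk_def)
next
  assume rk: "rk x = 1 + 2 * card (demands x)"
  have "\<not> rk z < rk x" if "(x, z) \<in> R" for z
  proof -
    have "\<not> dead z \<and> demands z = demands x" using rk assms that by (auto simp: rk_def split: if_splits)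
    then have "1 + 2 * card (demands x) \<le> rk z" by (simp add: rk_def)
    then show ?thesis using rk by simp
  qed
  then show "below x = {}" by (auto simp: below_def)
qed

text \<open>Colourings constant on edges stand for connectedness. Two points of one cluster share the
  successors of the representative, or coincide if it is a dead end. If \<open>y\<close> has smaller rank than
  \<open>x\<close>, the cluster of \<open>x\<close> records that of \<open>y\<close>, so the representative of \<open>x\<close> sees that
  cluster. Otherwise \<open>x\<close> and \<open>y\<close> have the same level, and either they share a cluster
  or both representatives see a common cluster of smaller rank.\<close>

lemma invariant_along_R:
  assumes X: "\<And>u v. u \<in> X \<Longrightarrow> (u, v) \<in> steps\<^sup>+ \<Longrightarrow> v \<in> X"
    and g: "\<And>u v. u \<in> X \<Longrightarrow> (u, v) \<in> steps\<^sup>+ \<Longrightarrow> g u = g v"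
    and xy: "(x, y) \<in> R" "node x \<in> X" "node y \<in> X"
  shows "g (node x) = g (node y)"
proof -
  have W: "x \<in> W" "y \<in> W" using xy(1) R_W by auto
  have sib: "g (node a) = g (node b)"
    if ab: "a \<in> W" "b \<in> W" "cluster a = cluster b" "node a \<in> X" "node b \<in> X" for a b
  proof (cases "dead a")
    case True
    then have "node a = node b" using ab cluster_eqD(6) by (simp add: node_eq_iff)
    then show ?thesis by simp
  next
    case False
    then have "\<not> dead (rep (cluster a))" using rep[OF ab(1)] cluster_eqD(4) by blast
    then obtain w where w: "(rep (cluster a), w) \<in> R" by (auto simp: dead_def)
    have "g (node a) = g (node w)" using step_rep[OF ab(1) w] by (rule g[OF ab(4)])
    moreover have "g (node b) = g (node w)"
      using step_rep[OF ab(2)] w ab(3) g[OF ab(5)] by simp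
    ultimately show ?thesis by simp
  qed
  have reach: "\<exists>w\<in>W. node w \<in> X \<and> cluster w = c \<and> g (node a) = g (node w)"
    if a: "a \<in> W" "node a \<in> X" "c \<in> below a" for a c
  proof -
    have "c \<in> below (rep (cluster a))" using a cluster_eqD(2)[OF rep(2)[OF a(1)]] by simp
    then obtain w where "(rep (cluster a), w) \<in> R" "cluster w = c" by (auto simp: below_def)
    then show ?thesis using step_rep[OF a(1)] X[OF a(2)] g[OF a(2)] R_W by blast
  qed
  show ?thesis
  proof (cases "rk y < rk x")
    case True
    then have "cluster y \<in> below x" using xy(1) by (auto simp: below_def)
    then obtain w where "w \<in> W" "node w \<in> X" "cluster w = cluster y" "g (node x) = g (node w)"
      using reach W xy by blast
    then show ?thesis using sib[of w y] W xy by simp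
  next
    case False
    then have lev: "level y = level x" using level_step[OF xy(1)] by simp
    note eq = level_eqD[OF lev]
    have sub: "below y \<subseteq> below x" using below_mono[OF xy(1)] eq by simp
    have nd: "\<not> dead x" using xy(1) by (auto simp: dead_def)
    show ?thesis
    proof (cases "below y = {}")
      case True
      then have "below x = {}" using below_empty_iff nd eq by simp
      then have "cluster x = cluster y" using lev True by (simp add: cluster_eq_iff)
      then show ?thesis using sib W xy by blast
    next
      case False
      then obtain c where c: "c \<in> below y" "c \<in> below x" using sub by blast
      obtain v where v: "v \<in> W" "node v \<in> X" "cluster v = c" "g (node y) = g (node v)"
        using reach[OF W(2) xy(3) c(1)] by blast
      obtain w where w: "w \<in> W" "node w \<in> X" "cluster w = c" "g (node x) = g (node w)"
        using reach[OF W(1) xy(2) c(2)] by blast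
      show ?thesis using sib[of v w] v w by simp
    qed
  qed
qed

text \<open>The successors of a point are connected to points seen by the representative of its cluster, so the
  representative sees every colour. Applying \<open>G\<^sub>n\<close> to the colour classes yields an accessible pair of
  worlds with points of different colours, against \<open>invariant_along_R\<close>.\<close>

lemma locally_connected_finite_frame:
  assumes G: "\<And>x. x \<in> W \<Longrightarrow> G_axioms n L \<subseteq> x"
  shows "locally_connected n finite_frame"
  unfolding locally_connected_def
proof
  fix u assume "u \<in> fst finite_frame"
  then obtain x where x: "x \<in> W" "u = node x" by (auto simp: finite_frame_def)
  define X where "X = steps\<^sup>+ `` {u}"
  define r where "r = rep (cluster x)"
  have r: "r \<in> W" using rep x by (simp add: r_def)
  have XN: "X \<subseteq> node ` W" using trancl_steps_W by (auto simp: X_def)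
  have Xup: "v \<in> X" if "w \<in> X" "(w, v) \<in> steps\<^sup>+" for w v
    using that trancl_trans by (fastforce simp: X_def)
  have rX: "node z \<in> X" if "(r, z) \<in> R" for z
    using step_rep[OF x(1)] that by (simp add: X_def r_def x)
  have "finite (path_components (restrict_frame finite_frame X)) \<and>
    card (path_components (restrict_frame finite_frame X)) \<le> n"
  proof (rule few_path_components)
    show "finite (fst (restrict_frame finite_frame X))"
      using XN finite_nodes finite_subset by (auto simp: restrict_frame_def)
    show "snd (restrict_frame finite_frame X) \<subseteq>
      fst (restrict_frame finite_frame X) \<times> fst (restrict_frame finite_frame X)"
      by (auto simp: restrict_frame_def)
    fix g :: "nat \<Rightarrow> nat"
    assume "\<And>u v. (u, v) \<in> snd (restrict_frame finite_frame X) \<Longrightarrow> g u = g v"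
    then have g: "g w = g v" if "w \<in> X" "(w, v) \<in> steps\<^sup>+" for w v
      using that Xup[OF that] by (simp add: restrict_frame_def finite_frame_def)
    assume "g ` fst (restrict_frame finite_frame X) = {..n}"
    then have onto: "g ` X = {..n}" by (simp add: restrict_frame_def)
    define P where "P i w \<longleftrightarrow> node w \<in> X \<and> g (node w) = i" for i w
    have "\<exists>z. (r, z) \<in> R \<and> (\<forall>i\<le>n. \<not> P i z \<or> (\<exists>w. (z, w) \<in> R \<and> \<not> P i w))"
    proof (rule G_in[OF r G[OF r]])
      show "definable (P i)" for i
        using discernible_definable[OF discernible_node, of "\<lambda>v. v \<in> X \<and> g v = i"]
        by (simp add: P_def[abs_def])
      show "i = j" if "P i w" "P j w" for i j w using that by (simp add: P_def)
      fix i assume "i \<le> n"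
      then obtain v where v: "v \<in> X" "g v = i" using onto by (metis atMost_iff imageE)
      then obtain v' where v': "(u, v') \<in> steps" "(v', v) \<in> steps\<^sup>*"
        using tranclD[of u v steps] by (auto simp: X_def)
      then obtain z where z: "(r, z) \<in> R" "v' = node z"
        using steps_iff x by (auto simp: r_def)
      have "g v' = g v" using v' rX[OF z(1)] g z(2) by (auto dest: rtranclD)
      then show "\<exists>y. (r, y) \<in> R \<and> P i y" using z v rX by (auto simp: P_def)
    qed
    then obtain z where z: "(r, z) \<in> R" "\<And>i. i \<le> n \<Longrightarrow> \<not> P i z \<or> (\<exists>w. (z, w) \<in> R \<and> \<not> P i w)"
      by blast
    have "g (node z) \<le> n" using onto rX[OF z(1)] by blast
    then obtain w where w: "(z, w) \<in> R" "\<not> P (g (node z)) w"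
      using z rX by (auto simp: P_def)
    then have "node w \<in> X" using rX R_trans z(1) by blast
    then have "g (node z) = g (node w)"
      using invariant_along_R[of X g z w] Xup g w(1) rX[OF z(1)] by blast
    then show False using w \<open>node w \<in> X\<close> by (simp add: P_def)
  qed
  then show "finite (path_components (restrict_frame finite_frame (snd finite_frame `` {u}))) \<and>
    card (path_components (restrict_frame finite_frame (snd finite_frame `` {u}))) \<le> n"
    by (simp add: X_def finite_frame_def)
qed

text \<open>The formula defining a colour class never changes its truth value along the accessibility
  relation, so the scheme for connectedness makes it true everywhere or nowhere.\<close>

lemma path_connected_finite_frame:
  assumes C: "\<And>x. x \<in> W \<Longrightarrow> C_axioms L \<subseteq> x" and Univ: "\<And>\<phi>. \<phi> \<in> L \<Longrightarrow> Univ \<phi> \<in> L"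
    and "W \<noteq> {}"
  shows "path_connected_frame finite_frame"
proof -
  obtain x where x: "x \<in> W" using \<open>W \<noteq> {}\<close> by blast
  have "finite (path_components finite_frame) \<and> card (path_components finite_frame) \<le> 1"
  proof (rule few_path_components)
    show "finite (fst finite_frame)" "snd finite_frame \<subseteq> fst finite_frame \<times> fst finite_frame"
      using finite_nodes trancl_steps_W by (simp_all add: finite_frame_def)
    fix g :: "nat \<Rightarrow> nat"
    assume "\<And>u v. (u, v) \<in> snd finite_frame \<Longrightarrow> g u = g v"
    then have g: "g u = g v" if "(u, v) \<in> steps\<^sup>+" for u v
      using that by (simp add: finite_frame_def)
    assume "g ` fst finite_frame = {..1}"
    then have onto: "g ` node ` W = {..1}" by (simp add: finite_frame_def)
    have R: "g (node y) = g (node z)" if "(y, z) \<in> R" for y z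
      using invariant_along_R[of "node ` W" g y z] trancl_steps_W that g R_W by blast
    obtain \<phi> where \<phi>: "\<phi> \<in> L" "\<And>y. y \<in> W \<Longrightarrow> \<phi> \<in> y \<longleftrightarrow> g (node y) = 0"
      using discernible_definable[OF discernible_node, of "\<lambda>v. g v = 0"]
      by (auto simp: definable_def)
    have UL: "Univ \<phi> \<in> L" "Univ (Neg \<phi>) \<in> L" using Univ \<phi> by auto
    have "Or (BoxS \<phi>) (BoxS (Neg \<phi>)) \<in> y" if y: "y \<in> W" for y
    proof (cases "\<phi> \<in> y")
      case True
      then have "Box \<phi> \<in> y" using R[of y] \<phi> y R_W Box_in[OF y \<phi>(1)] by metis
      then show ?thesis using True y \<phi> by simp
    next
      case False
      then have "Box (Neg \<phi>) \<in> y" using R[of y] \<phi> y R_W Box_in[OF y, of "Neg \<phi>"] by (metis Neg_L Neg_in)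
      then show ?thesis using False y \<phi> by simp
    qed
    then have "Univ (Or (BoxS \<phi>) (BoxS (Neg \<phi>))) \<in> x"
      using Univ_in[OF x] Univ \<phi> by simp
    moreover have "Imp (Univ (Or (BoxS \<phi>) (BoxS (Neg \<phi>)))) (Or (Univ \<phi>) (Univ (Neg \<phi>))) \<in> x"
      using C[OF x] \<phi> by (auto simp: C_axioms_def)
    ultimately have "Univ \<phi> \<in> x \<or> Univ (Neg \<phi>) \<in> x"
      using x \<phi>(1) UL Univ by simp
    then have "(\<forall>y\<in>W. g (node y) = 0) \<or> (\<forall>y\<in>W. g (node y) \<noteq> 0)"
      using Univ_in[OF x UL(1)] Univ_in[OF x UL(2)] \<phi> by simp
    moreover have "0 \<in> g ` node ` W" "1 \<in> g ` node ` W" using onto by auto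
    ultimately show False by force
  qed
  moreover have "path_components finite_frame \<noteq> {}"
    using x by (auto simp: path_components_def finite_frame_def quotient_def)
  ultimately show ?thesis
    unfolding path_connected_frame_def by (metis card_0_eq le_antisym less_one not_le)
qed

lemma finite_frame_lc_trans:
  assumes "W \<noteq> {}" "\<And>x. x \<in> W \<Longrightarrow> G_axioms n L \<subseteq> x"
  shows "finite_frame \<in> lc_trans_frames n"
  using assms locally_connected_finite_frame trancl_steps_W
  by (auto simp: lc_trans_frames_def is_frame_def finite_frame_def)

lemma serial_finite_frame:
  assumes "\<And>x. x \<in> W \<Longrightarrow> Dia Top \<in> x"
  shows "serial_frame finite_frame"
proof -
  have "\<exists>v. (node x, v) \<in> steps\<^sup>+" if x: "x \<in> W" for x
  proof -
    have "Dia Top \<in> rep (cluster x)" using assms rep(1)[OF x] by blast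
    then have "\<exists>z. (rep (cluster x), z) \<in> R"
      unfolding Dia_in[OF rep(1)[OF x] Top_L] by blast
    then show ?thesis using step_rep[OF x] by blast
  qed
  then show ?thesis by (auto simp: serial_frame_def finite_frame_def)
qed

end

context tangle_worlds
begin

lemma filtration_exists: "\<phi> \<in> L \<Longrightarrow> \<exists>\<Phi>. \<phi> \<in> \<Phi> \<and> tangle_filtration_axioms L \<Phi>"
proof (induction \<phi> rule: measure_induct_rule[where f = size])
  case (less \<phi>)
  have "parts \<phi> \<subseteq> L" using less.prems Univ_L Tangle_L by (cases \<phi>) auto
  moreover have "size \<psi> < size \<phi>" if "\<psi> \<in> parts \<phi>" for \<psi>
    using that size_less_Tangle by (cases \<phi>) auto
  ultimately have "\<forall>\<psi>\<in>parts \<phi>. \<exists>\<Phi>. \<psi> \<in> \<Phi> \<and> tangle_filtration_axioms L \<Phi>" using less.IH by blast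
  then obtain F where F: "\<And>\<psi>. \<psi> \<in> parts \<phi> \<Longrightarrow> \<psi> \<in> F \<psi>"
    "\<And>\<psi>. \<psi> \<in> parts \<phi> \<Longrightarrow> tangle_filtration_axioms L (F \<psi>)"
    by metis
  have "finite (parts \<phi>)" by (cases \<phi>) auto
  then have "tangle_filtration_axioms L (insert \<phi> (\<Union>\<psi>\<in>parts \<phi>. F \<psi>))"
  proof (unfold_locales)
    note F' = F(2)[unfolded tangle_filtration_axioms_def]
    show "finite (insert \<phi> (\<Union>\<psi>\<in>parts \<phi>. F \<psi>))" using \<open>finite (parts \<phi>)\<close> F' by auto
    fix \<chi> assume \<chi>: "\<chi> \<in> insert \<phi> (\<Union>\<psi>\<in>parts \<phi>. F \<psi>)"
    show "\<chi> \<in> L" using \<chi> F' less.prems by (elim insertE UN_E) auto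
    show "parts \<chi> \<subseteq> insert \<phi> (\<Union>\<psi>\<in>parts \<phi>. F \<psi>)"
    proof (cases "\<chi> = \<phi>")
      case True
      then show ?thesis using F(1) by auto
    next
      case False
      then obtain \<psi> where "\<psi> \<in> parts \<phi>" "\<chi> \<in> F \<psi>" using \<chi> by blast
      then have "parts \<chi> \<subseteq> F \<psi>" using F' by simp
      then show ?thesis using \<open>\<psi> \<in> parts \<phi>\<close> by blast
    qed
  qed
  then show ?case by blast
qed

theorem finite_model:
  assumes "x \<in> W" "\<phi> \<in> L" "\<phi> \<in> x" and G: "\<And>x. x \<in> W \<Longrightarrow> G_axioms n L \<subseteq> x"
  obtains F :: "nat frame" and h w where
    "F \<in> lc_trans_frames n" "finite (fst F)" "\<forall>p. h p \<subseteq> fst F" "w \<in> fst F" "sat F h w \<phi>"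
    "(\<And>x. x \<in> W \<Longrightarrow> Dia Top \<in> x) \<Longrightarrow> serial_frame F"
    "(\<And>x. x \<in> W \<Longrightarrow> C_axioms L \<subseteq> x) \<Longrightarrow> (\<And>\<phi>. \<phi> \<in> L \<Longrightarrow> Univ \<phi> \<in> L) \<Longrightarrow> path_connected_frame F"
proof -
  obtain \<Phi> where "\<phi> \<in> \<Phi>" "tangle_filtration_axioms L \<Phi>" using filtration_exists assms by blast
  then interpret tangle_filtration L W R \<Phi>
    by (intro tangle_filtration.intro tangle_worlds_axioms)
  have "W \<noteq> {}" using assms by blast
  show thesis
  proof (rule that[of finite_frame valuation "node x"])
    show "finite_frame \<in> lc_trans_frames n" using finite_frame_lc_trans[OF \<open>W \<noteq> {}\<close> G] .
    show "finite (fst finite_frame)" using finite_nodes by (simp add: finite_frame_def)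
    show "\<forall>p. valuation p \<subseteq> fst finite_frame" by (auto simp: valuation_def finite_frame_def)
    show "node x \<in> fst finite_frame" using assms by (simp add: finite_frame_def)
    show "sat finite_frame valuation (node x) \<phi>" using truth assms \<open>\<phi> \<in> \<Phi>\<close> by blast
  qed (use serial_finite_frame path_connected_finite_frame \<open>W \<noteq> {}\<close> in blast)+
qed

end

section \<open>Canonical worlds\<close>

definition boolean_valuation :: "('v fm \<Rightarrow> bool) \<Rightarrow> bool" where
  "boolean_valuation v \<longleftrightarrow> v Top \<and> (\<forall>\<phi>. v (Neg \<phi>) = (\<not> v \<phi>)) \<and> (\<forall>\<phi> \<psi>. v (And \<phi> \<psi>) = (v \<phi> \<and> v \<psi>))"

text \<open>The propositional form of a formula, in which the numbering \<open>g\<close> turns the propositionally indivisible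
  subformulas into variables. It need only be injective on the finitely many that occur, so the
  set of atoms may be uncountable.\<close>

fun skeleton :: "('v fm \<Rightarrow> nat) \<Rightarrow> 'v fm \<Rightarrow> pfm" where
  "skeleton g Top = PTop"
| "skeleton g (Neg \<phi>) = PNeg (skeleton g \<phi>)"
| "skeleton g (And \<phi> \<psi>) = PAnd (skeleton g \<phi>) (skeleton g \<psi>)"
| "skeleton g \<phi> = PVar (g \<phi>)"

fun primes :: "'v fm \<Rightarrow> 'v fm set" where
  "primes Top = {}"
| "primes (Neg \<phi>) = primes \<phi>"
| "primes (And \<phi> \<psi>) = primes \<phi> \<union> primes \<psi>"
| "primes \<phi> = {\<phi>}"

lemma psubst_skeleton: "(\<And>\<psi>. \<psi> \<in> primes \<phi> \<Longrightarrow> \<sigma> (g \<psi>) = \<psi>) \<Longrightarrow> psubst \<sigma> (skeleton g \<phi>) = \<phi>"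
  by (induction \<phi>) auto

lemma finite_primes: "finite (primes \<phi>)"
  by (induction \<phi>) auto

text \<open>Tautologies can thus be checked with valuations of formulas, without exhibiting a scheme and a
  substitution each time.\<close>

lemma valid_in_K4t:
  assumes "\<And>v. boolean_valuation v \<Longrightarrow> v \<phi>" "\<phi> \<in> L"
  shows "\<phi> \<in> K4t L"
proof -
  obtain g :: "'a fm \<Rightarrow> nat" where g: "inj_on g (primes \<phi>)"
    using finite_imp_inj_to_nat_seg[OF finite_primes[of \<phi>]] by auto
  have eq: "psubst (inv_into (primes \<phi>) g) (skeleton g \<phi>) = \<phi>"
    by (rule psubst_skeleton) (simp add: g)
  have "pval e (skeleton g \<phi>)" for e
    by (rule assms(1)[of "\<lambda>\<psi>. pval e (skeleton g \<psi>)"]) (simp add: boolean_valuation_def)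
  then have "tautology (skeleton g \<phi>)" by (simp add: tautology_def)
  from K4t.Taut[OF this, of "inv_into (primes \<phi>) g" L] show ?thesis using assms(2) eq by simp
qed

locale tangle_logic = language L for L :: "'v fm set" +
  fixes T :: "'v fm set"
  assumes K4t_T: "K4t L \<subseteq> T"
    and mp_T: "Imp \<phi> \<psi> \<in> T \<Longrightarrow> \<phi> \<in> T \<Longrightarrow> \<psi> \<in> T"
    and Box_T: "\<phi> \<in> T \<Longrightarrow> Box \<phi> \<in> T"
begin

definition deductive :: "'v fm set \<Rightarrow> bool" where
  "deductive F \<longleftrightarrow> F \<subseteq> L \<and> T \<inter> L \<subseteq> F \<and> (\<forall>\<phi> \<psi>. Imp \<phi> \<psi> \<in> F \<longrightarrow> \<phi> \<in> F \<longrightarrow> \<psi> \<in> F)"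

definition world :: "'v fm set \<Rightarrow> bool" where
  "world x \<longleftrightarrow> deductive x \<and> (\<forall>\<phi>\<in>L. Neg \<phi> \<in> x \<longleftrightarrow> \<phi> \<notin> x)"

definition acc :: "'v fm set \<Rightarrow> 'v fm set \<Rightarrow> bool" where
  "acc x y \<longleftrightarrow> (\<forall>\<phi>. Box \<phi> \<in> x \<longrightarrow> \<phi> \<in> y)"

lemma deductive_mp: "deductive F \<Longrightarrow> Imp \<phi> \<psi> \<in> F \<Longrightarrow> \<phi> \<in> F \<Longrightarrow> \<psi> \<in> F"
  by (auto simp: deductive_def)

lemma valid_T:
  "\<phi> \<in> L \<Longrightarrow> (\<And>v. boolean_valuation v \<Longrightarrow> v \<phi>) \<Longrightarrow> \<phi> \<in> T"
  using valid_in_K4t K4t_T by blast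

lemma deductive_valid:
  "deductive F \<Longrightarrow> \<phi> \<in> L \<Longrightarrow> (\<And>v. boolean_valuation v \<Longrightarrow> v \<phi>) \<Longrightarrow> \<phi> \<in> F"
  using valid_T by (auto simp: deductive_def)

lemma deductive_T: "deductive (T \<inter> L)"
  using mp_T by (auto simp: deductive_def)

text \<open>In a maximal deductive set omitting \<open>\<phi>\<close>, every \<open>\<psi>\<close> left out satisfies \<open>\<psi> \<rightarrow> \<phi>\<close>;
  if \<open>Neg \<psi>\<close> were left out too, \<open>\<phi>\<close> would follow by cases.\<close>

lemma lindenbaum:
  assumes F: "deductive F" and \<phi>: "\<phi> \<in> L" "\<phi> \<notin> F"
  obtains x where "world x" "F \<subseteq> x" "\<phi> \<notin> x"
proof -
  define A where "A = {G. deductive G \<and> F \<subseteq> G \<and> \<phi> \<notin> G}"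
  have "\<exists>M\<in>A. \<forall>X\<in>A. M \<subseteq> X \<longrightarrow> X = M"
  proof (rule subset_Zorn_nonempty)
    show "A \<noteq> {}" using F \<phi> by (auto simp: A_def)
    fix C assume C: "C \<noteq> {}" "subset.chain A C"
    then have sub: "C \<subseteq> A" and lin: "\<And>G H. G \<in> C \<Longrightarrow> H \<in> C \<Longrightarrow> G \<subseteq> H \<or> H \<subseteq> G"
      by (auto simp: subset.chain_def)
    have "deductive (\<Union>C)"
      unfolding deductive_def
    proof (intro conjI allI impI)
      show "\<Union>C \<subseteq> L" "T \<inter> L \<subseteq> \<Union>C" using sub C(1) by (fastforce simp: A_def deductive_def)+
      fix \<psi> \<chi> assume "Imp \<psi> \<chi> \<in> \<Union>C" "\<psi> \<in> \<Union>C"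
      then obtain G H where GH: "G \<in> C" "H \<in> C" "Imp \<psi> \<chi> \<in> G" "\<psi> \<in> H" by blast
      then obtain M where "M \<in> C" "Imp \<psi> \<chi> \<in> M" "\<psi> \<in> M" using lin[of G H] by blast
      moreover from this have "deductive M" using sub by (auto simp: A_def)
      ultimately show "\<chi> \<in> \<Union>C" using deductive_mp by blast
    qed
    then show "\<Union>C \<in> A" using sub C(1) by (auto simp: A_def)
  qed
  then obtain x where x: "x \<in> A" and max: "\<And>X. X \<in> A \<Longrightarrow> x \<subseteq> X \<Longrightarrow> X = x" by blast
  have dx: "deductive x" and Fx: "F \<subseteq> x" and \<phi>x: "\<phi> \<notin> x" using x by (auto simp: A_def)
  have xL: "x \<subseteq> L" using dx by (simp add: deductive_def)
  have extend: "Imp \<psi> \<phi> \<in> x" if \<psi>: "\<psi> \<in> L" "\<psi> \<notin> x" for \<psi>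
  proof (rule ccontr)
    assume no: "Imp \<psi> \<phi> \<notin> x"
    let ?G = "{\<chi> \<in> L. Imp \<psi> \<chi> \<in> x}"
    have weak: "\<chi> \<in> ?G" if "\<chi> \<in> x" for \<chi>
    proof -
      have "\<chi> \<in> L" using that xL by blast
      then have "Imp \<chi> (Imp \<psi> \<chi>) \<in> x"
        using \<psi> by (intro deductive_valid[OF dx]) (auto simp: boolean_valuation_def)
      then show ?thesis using deductive_mp[OF dx _ that] \<open>\<chi> \<in> L\<close> by blast
    qed
    have "deductive ?G"
      unfolding deductive_def
    proof (intro conjI allI impI)
      show "?G \<subseteq> L" by blast
      show "T \<inter> L \<subseteq> ?G" using dx weak unfolding deductive_def by blast
      fix \<chi> \<theta> assume a: "Imp \<chi> \<theta> \<in> ?G" "\<chi> \<in> ?G"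
      then have "Imp (Imp \<psi> (Imp \<chi> \<theta>)) (Imp (Imp \<psi> \<chi>) (Imp \<psi> \<theta>)) \<in> x"
        using \<psi> by (intro deductive_valid[OF dx]) (auto simp: boolean_valuation_def)
      then have "Imp \<psi> \<theta> \<in> x" using a deductive_mp[OF dx] by blast
      then show "\<theta> \<in> ?G" using a by simp
    qed
    moreover have "\<psi> \<in> ?G"
      using \<psi> deductive_valid[OF dx, of "Imp \<psi> \<psi>"] by (auto simp: boolean_valuation_def)
    ultimately have "?G \<in> A" "x \<subseteq> ?G" using Fx weak no by (auto simp: A_def)
    then show False using max \<open>\<psi> \<in> ?G\<close> \<psi> by blast
  qed
  have "Neg \<psi> \<in> x \<longleftrightarrow> \<psi> \<notin> x" if \<psi>: "\<psi> \<in> L" for \<psi>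
  proof
    assume "Neg \<psi> \<in> x"
    moreover have "Imp (Neg \<psi>) (Imp \<psi> \<phi>) \<in> x"
      using \<psi> \<phi> by (intro deductive_valid[OF dx]) (auto simp: boolean_valuation_def)
    ultimately show "\<psi> \<notin> x" using deductive_mp[OF dx] \<phi>x by blast
  next
    assume "\<psi> \<notin> x"
    then have "Imp \<psi> \<phi> \<in> x" using extend \<psi> by blast
    moreover have "Imp (Imp \<psi> \<phi>) (Imp (Imp (Neg \<psi>) \<phi>) \<phi>) \<in> x"
      using \<psi> \<phi> by (intro deductive_valid[OF dx]) (auto simp: boolean_valuation_def)
    ultimately have "Imp (Neg \<psi>) \<phi> \<notin> x" using deductive_mp[OF dx] \<phi>x by blast
    then show "Neg \<psi> \<in> x" using extend[of "Neg \<psi>"] \<psi> by auto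
  qed
  then have "world x" using dx by (simp add: world_def)
  then show thesis using that Fx \<phi>x by blast
qed

lemma consistent_world:
  assumes "\<phi> \<in> L" "Neg \<phi> \<notin> T"
  obtains x where "world x" "\<phi> \<in> x"
proof -
  obtain x where "world x" "Neg \<phi> \<notin> x"
    using lindenbaum[OF deductive_T, of "Neg \<phi>"] assms by auto
  then show thesis using that assms by (auto simp: world_def)
qed

context
  fixes x assumes x: "world x"
begin

lemma world_deductive: "deductive x" and world_L: "\<phi> \<in> x \<Longrightarrow> \<phi> \<in> L"
  and world_T: "\<phi> \<in> T \<Longrightarrow> \<phi> \<in> L \<Longrightarrow> \<phi> \<in> x"
  and world_Neg: "\<phi> \<in> L \<Longrightarrow> Neg \<phi> \<in> x \<longleftrightarrow> \<phi> \<notin> x"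
  using x by (auto simp: world_def deductive_def)

lemma world_mp: "Imp \<phi> \<psi> \<in> T \<Longrightarrow> \<phi> \<in> x \<Longrightarrow> \<psi> \<in> L \<Longrightarrow> \<psi> \<in> x"
  using deductive_mp[OF world_deductive, of \<phi> \<psi>] world_T[of "Imp \<phi> \<psi>"] world_L[of \<phi>] by simp

lemma world_And:
  assumes "\<phi> \<in> L" "\<psi> \<in> L"
  shows "And \<phi> \<psi> \<in> x \<longleftrightarrow> \<phi> \<in> x \<and> \<psi> \<in> x"
proof -
  note v = deductive_valid[OF world_deductive] and m = deductive_mp[OF world_deductive]
  have "Imp (And \<phi> \<psi>) \<phi> \<in> x" "Imp (And \<phi> \<psi>) \<psi> \<in> x" "Imp \<phi> (Imp \<psi> (And \<phi> \<psi>)) \<in> x"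
    using assms by (auto intro!: v simp: boolean_valuation_def)
  then show ?thesis using m by blast
qed

lemma Box_deductive: "deductive {\<phi>. Box \<phi> \<in> x}"
  unfolding deductive_def
proof (intro conjI allI impI)
  show "{\<phi>. Box \<phi> \<in> x} \<subseteq> L" using world_L Box_L by blast
  show "T \<inter> L \<subseteq> {\<phi>. Box \<phi> \<in> x}" using Box_T world_T by auto
  fix \<phi> \<psi> assume a: "Imp \<phi> \<psi> \<in> {\<phi>. Box \<phi> \<in> x}" "\<phi> \<in> {\<phi>. Box \<phi> \<in> x}"
  then have "\<phi> \<in> L" "\<psi> \<in> L" using world_L by fastforce+
  then have "Imp (Box (Imp \<phi> \<psi>)) (Imp (Box \<phi>) (Box \<psi>)) \<in> x"
    using K4t.K K4t_T by (intro world_T) auto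
  then show "\<psi> \<in> {\<phi>. Box \<phi> \<in> x}" using a deductive_mp[OF world_deductive] by blast
qed

lemma world_Box:
  assumes "\<phi> \<in> L" shows "Box \<phi> \<in> x \<longleftrightarrow> (\<forall>y. world y \<longrightarrow> acc x y \<longrightarrow> \<phi> \<in> y)"
proof
  assume all: "\<forall>y. world y \<longrightarrow> acc x y \<longrightarrow> \<phi> \<in> y"
  show "Box \<phi> \<in> x"
  proof (rule ccontr)
    assume "Box \<phi> \<notin> x"
    then obtain y where "world y" "{\<phi>. Box \<phi> \<in> x} \<subseteq> y" "\<phi> \<notin> y"
      using lindenbaum[OF Box_deductive assms] by blast
    then show False using all by (auto simp: acc_def)
  qed
qed (auto simp: acc_def)

lemma world_Dia:
  assumes "\<phi> \<in> L" shows "Dia \<phi> \<in> x \<longleftrightarrow> (\<exists>y. world y \<and> acc x y \<and> \<phi> \<in> y)"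
proof -
  have "Dia \<phi> \<in> x \<longleftrightarrow> Box (Neg \<phi>) \<notin> x" using assms world_Neg by simp
  then show ?thesis using world_Box[of "Neg \<phi>"] assms by (auto simp: world_def)
qed

end

lemma acc_trans:
  assumes w: "world x" "world y" "world z" and acc: "acc x y" "acc y z"
  shows "acc x z"
  unfolding acc_def
proof (intro allI impI)
  fix \<phi> assume \<phi>: "Box \<phi> \<in> x"
  then have L: "\<phi> \<in> L" using world_L[OF w(1)] by fastforce
  show "\<phi> \<in> z"
  proof (rule ccontr)
    assume "\<phi> \<notin> z"
    then have "Neg \<phi> \<in> z" using world_Neg[OF w(3) L] by blast
    then have "Dia (Neg \<phi>) \<in> y" using world_Dia[OF w(2)] w acc L by auto
    then have "Dia (Dia (Neg \<phi>)) \<in> x" using world_Dia[OF w(1)] w acc L by auto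
    moreover have "Imp (Dia (Dia (Neg \<phi>))) (Dia (Neg \<phi>)) \<in> T" using K4t.Four[of "Neg \<phi>" L] K4t_T L by auto
    ultimately have "Dia (Neg \<phi>) \<in> x" using world_mp[OF w(1)] L by simp
    then show False using world_Dia[OF w(1), of "Neg \<phi>"] L \<phi> world_Neg by (auto simp: acc_def)
  qed
qed

text \<open>Any family of worlds closed under accessibility inherits the truth conditions for boxes and
  tangles; only that for \<open>Univ\<close> depends on the family.\<close>

lemma canonical:
  assumes W: "\<And>x. x \<in> W \<Longrightarrow> world x" and closed: "\<And>x y. x \<in> W \<Longrightarrow> world y \<Longrightarrow> acc x y \<Longrightarrow> y \<in> W"
    and Univ: "\<And>x \<phi>. x \<in> W \<Longrightarrow> Univ \<phi> \<in> L \<Longrightarrow> Univ \<phi> \<in> x \<longleftrightarrow> (\<forall>y\<in>W. \<phi> \<in> y)"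
  shows "tangle_worlds L W {(x, y). x \<in> W \<and> y \<in> W \<and> acc x y}"
proof -
  let ?R = "{(x, y). x \<in> W \<and> y \<in> W \<and> acc x y}"
  have R: "(x, y) \<in> ?R \<longleftrightarrow> world y \<and> acc x y" if "x \<in> W" for x y
    using W closed that by blast
  have Dia: "Dia \<phi> \<in> x \<longleftrightarrow> (\<exists>y. (x, y) \<in> ?R \<and> \<phi> \<in> y)" if "x \<in> W" "\<phi> \<in> L" for x \<phi>
    unfolding world_Dia[OF W[OF that(1)] that(2)] R[OF that(1)] by blast
  have Box: "Box \<phi> \<in> x \<longleftrightarrow> (\<forall>y. (x, y) \<in> ?R \<longrightarrow> \<phi> \<in> y)" if "x \<in> W" "\<phi> \<in> L" for x \<phi>
    unfolding world_Box[OF W[OF that(1)] that(2)] R[OF that(1)] by blast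
  have Imp: "Imp \<phi> \<psi> \<in> x \<longleftrightarrow> (\<phi> \<in> x \<longrightarrow> \<psi> \<in> x)" if "x \<in> W" "\<phi> \<in> L" "\<psi> \<in> L" for x \<phi> \<psi>
    using that world_Neg[OF W] world_And[OF W] by simp
  have conj: "Conj \<phi>s \<in> x" if "x \<in> W" "set \<phi>s \<subseteq> x" for x \<phi>s
    using that(2)
  proof (induction \<phi>s)
    case Nil
    show ?case using deductive_valid[OF world_deductive[OF W[OF that(1)]], of Top]
      by (simp add: boolean_valuation_def)
  next
    case (Cons \<phi> \<phi>s)
    then have x: "Conj \<phi>s \<in> x" "\<phi> \<in> x" by simp_all
    then show ?case
      using world_And[OF W[OF that(1)], of \<phi> "Conj \<phi>s"] x[THEN world_L[OF W[OF that(1)]]] by simp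
  qed
  show ?thesis
  proof unfold_locales
    fix x y z assume "(x, y) \<in> ?R" "(y, z) \<in> ?R"
    then show "(x, z) \<in> ?R" using acc_trans[OF W W W] by auto
  next
    fix x assume "x \<in> W"
    then show "Top \<in> x" using conj[of x "[]"] by simp
  next
    fix x \<Gamma> \<gamma> assume a: "x \<in> W" "Tangle \<Gamma> \<in> L" "Tangle \<Gamma> \<in> x" "\<gamma> \<in> fset \<Gamma>"
    then have \<gamma>: "\<gamma> \<in> L" using Tangle_L by blast
    then have "Dia (And \<gamma> (Tangle \<Gamma>)) \<in> x"
      using a K4t.Fix K4t_T by (intro world_mp[OF W[OF a(1)] _ a(3)]) auto
    then obtain y where y: "(x, y) \<in> ?R" "And \<gamma> (Tangle \<Gamma>) \<in> y" using Dia a \<gamma> by auto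
    then have "\<gamma> \<in> y \<and> Tangle \<Gamma> \<in> y" using world_And[OF W \<gamma> a(2), of y] by simp
    then show "\<exists>y. (x, y) \<in> ?R \<and> \<gamma> \<in> y \<and> Tangle \<Gamma> \<in> y" using y by blast
  next
    fix x \<Gamma> \<phi>
    assume a: "x \<in> W" "Tangle \<Gamma> \<in> L" "\<phi> \<in> L" "\<phi> \<in> x"
      and step: "\<And>y \<gamma>. y = x \<or> (x, y) \<in> ?R \<Longrightarrow> \<phi> \<in> y \<Longrightarrow> \<gamma> \<in> fset \<Gamma> \<Longrightarrow>
        \<exists>z. (y, z) \<in> ?R \<and> \<gamma> \<in> z \<and> \<phi> \<in> z"
    obtain \<gamma>s where \<gamma>s: "set \<gamma>s = fset \<Gamma>" using finite_list[of "fset \<Gamma>"] by auto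
    let ?C = "Conj (map (\<lambda>\<gamma>. Dia (And \<gamma> \<phi>)) \<gamma>s)"
    have \<Gamma>L: "\<gamma> \<in> L" if "\<gamma> \<in> fset \<Gamma>" for \<gamma> using Tangle_L a that by blast
    then have CL: "?C \<in> L" using \<gamma>s a by auto
    have imp: "Imp \<phi> ?C \<in> y" if y: "y = x \<or> (x, y) \<in> ?R" for y
    proof -
      have yW: "y \<in> W" using y a by auto
      have "Dia (And \<gamma> \<phi>) \<in> y" if \<phi>\<gamma>: "\<phi> \<in> y" "\<gamma> \<in> fset \<Gamma>" for \<gamma>
      proof -
        obtain z where z: "(y, z) \<in> ?R" "\<gamma> \<in> z" "\<phi> \<in> z" using step[OF y \<phi>\<gamma>] by blast
        then have "And \<gamma> \<phi> \<in> z" using world_And[OF W \<Gamma>L[OF \<phi>\<gamma>(2)] a(3), of z] by simp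
        then show ?thesis using Dia[OF yW, of "And \<gamma> \<phi>"] z \<Gamma>L[OF \<phi>\<gamma>(2)] a by auto
      qed
      then show ?thesis
        unfolding Imp[OF yW a(3) CL] using conj[OF yW] \<gamma>s by (auto simp: image_subset_iff)
    qed
    have IL: "Imp \<phi> ?C \<in> L" and BL: "Box (Imp \<phi> ?C) \<in> L" using a CL by simp_all
    have "BoxS (Imp \<phi> ?C) \<in> x"
      unfolding world_And[OF W[OF a(1)] IL BL] Box[OF a(1) IL] using imp by blast
    moreover have "Imp \<phi> (Tangle \<Gamma>) \<in> L" using a by simp
    ultimately have "Imp \<phi> (Tangle \<Gamma>) \<in> x"
      by (rule world_mp[OF W[OF a(1)] subsetD[OF K4t_T K4t.Ind[OF a(2,3) \<gamma>s]]])
    then show "Tangle \<Gamma> \<in> x" using Imp a by blast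
  qed (use Univ Box world_Neg[OF W] world_And[OF W] in auto)
qed

end

section \<open>The finite model property\<close>

lemma (in language) G_axioms_L: "G_axioms n L \<subseteq> L"
proof -
  have "Conj (map f [0..<Suc n]) \<in> L" if "\<And>i. i \<le> n \<Longrightarrow> f i \<in> L" for f
    using that by (auto simp: less_Suc_eq_le)
  moreover have "G_Q n \<phi> i \<in> L" if "i \<le> n" "\<forall>i\<le>n. \<phi> i \<in> L" for \<phi> i
    using that by (auto simp: G_Q_def less_Suc_eq_le)
  ultimately show ?thesis unfolding G_axioms_def by auto
qed

lemma (in tangle_logic) box_model:
  assumes "\<And>\<phi>. Univ \<phi> \<notin> L" "G_axioms n L \<subseteq> T" "\<phi> \<in> L" "Neg \<phi> \<notin> T"
  shows "\<exists>F :: nat frame. F \<in> lc_trans_frames n \<and> (Dia Top \<in> T \<longrightarrow> serial_frame F) \<and>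
    finite (fst F) \<and> (\<exists>h. (\<forall>p. h p \<subseteq> fst F) \<and> (\<exists>w\<in>fst F. sat F h w \<phi>))"
proof -
  obtain x where x: "world x" "\<phi> \<in> x" using consistent_world assms by blast
  interpret tangle_worlds L "Collect world" "{(x, y). x \<in> Collect world \<and> y \<in> Collect world \<and> acc x y}"
    by (rule canonical) (use assms in auto)
  have "G_axioms n L \<subseteq> y" if "y \<in> Collect world" for y
    using that assms G_axioms_L[of n] world_T by blast
  with x assms(3) obtain F :: "nat frame" and h w where
    "F \<in> lc_trans_frames n" "finite (fst F)" "\<forall>p. h p \<subseteq> fst F" "w \<in> fst F" "sat F h w \<phi>"
    "(\<And>x. x \<in> Collect world \<Longrightarrow> Dia Top \<in> x) \<Longrightarrow> serial_frame F"
    by (elim finite_model[rotated 3]) auto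
  moreover have "Dia Top \<in> y" if "Dia Top \<in> T" "y \<in> Collect world" for y
    using that world_T[of y "Dia Top"] by simp
  ultimately show ?thesis by blast
qed

locale tangle_logic_U = tangle_logic L T for L T :: "'v fm set" +
  assumes Univ_L_iff: "Univ \<phi> \<in> L \<longleftrightarrow> \<phi> \<in> L"
    and U_T: "U_axioms L \<subseteq> T" and Univ_T: "\<phi> \<in> T \<Longrightarrow> Univ \<phi> \<in> T"
begin

lemma Univ_deductive:
  assumes x: "world x" shows "deductive {\<phi>. Univ \<phi> \<in> x}"
  unfolding deductive_def
proof (intro conjI allI impI)
  show "{\<phi>. Univ \<phi> \<in> x} \<subseteq> L" using world_L[OF x] Univ_L by blast
  show "T \<inter> L \<subseteq> {\<phi>. Univ \<phi> \<in> x}" using Univ_T world_T[OF x] Univ_L_iff by auto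
  fix \<phi> \<psi> assume a: "Imp \<phi> \<psi> \<in> {\<phi>. Univ \<phi> \<in> x}" "\<phi> \<in> {\<phi>. Univ \<phi> \<in> x}"
  then have "Univ (Imp \<phi> \<psi>) \<in> L" using world_L[OF x] by blast
  then have "\<phi> \<in> L" "\<psi> \<in> L" by (auto simp: Univ_L_iff)
  then have "Imp (Univ (Imp \<phi> \<psi>)) (Imp (Univ \<phi>) (Univ \<psi>)) \<in> x"
    using U_axioms.Univ_K U_T by (intro world_T[OF x]) (auto simp: Univ_L_iff)
  then show "\<psi> \<in> {\<phi>. Univ \<phi> \<in> x}" using a deductive_mp[OF world_deductive[OF x]] by blast
qed

text \<open>The equivalence class of a world under agreement on universal formulas; the S5 axioms allow the
  one-sided description (\<open>Univ_sphere\<close>).\<close>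

definition sphere :: "'v fm set \<Rightarrow> 'v fm set set" where
  "sphere x = {y. world y \<and> (\<forall>\<phi>. Univ \<phi> \<in> x \<longrightarrow> \<phi> \<in> y)}"

lemma Univ_Univ: "world x \<Longrightarrow> Univ \<phi> \<in> x \<Longrightarrow> Univ (Univ \<phi>) \<in> x"
  using world_mp[of x "Univ \<phi>" "Univ (Univ \<phi>)"] world_L[of x "Univ \<phi>"] U_axioms.Univ_4 U_T
  by (auto simp: Univ_L_iff)

lemma Univ_sphere:
  assumes x: "world x" and y: "y \<in> sphere x"
  shows "Univ \<phi> \<in> y \<longleftrightarrow> Univ \<phi> \<in> x"
proof
  have yw: "world y" using y by (simp add: sphere_def)
  show "Univ \<phi> \<in> y" if "Univ \<phi> \<in> x"
    using Univ_Univ[OF x that] y by (auto simp: sphere_def)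
  assume \<phi>: "Univ \<phi> \<in> y"
  then have L: "\<phi> \<in> L" "Univ \<phi> \<in> L" using world_L[OF yw \<phi>] by (auto simp: Univ_L_iff)
  show "Univ \<phi> \<in> x"
  proof (rule ccontr)
    assume "Univ \<phi> \<notin> x"
    then have "Neg (Univ \<phi>) \<in> x" using world_Neg[OF x L(2)] by blast
    moreover have "Imp (Neg (Univ \<phi>)) (Univ (Exi (Neg (Univ \<phi>)))) \<in> T"
      using L by (intro subsetD[OF U_T U_axioms.Univ_B]) simp
    ultimately have "Univ (Exi (Neg (Univ \<phi>))) \<in> x"
      using L world_mp[OF x] by (simp add: Univ_L_iff)
    then have "Exi (Neg (Univ \<phi>)) \<in> y" using y by (auto simp: sphere_def)
    then have "Univ (Neg (Neg (Univ \<phi>))) \<notin> y" using world_Neg[OF yw] L by (simp add: Univ_L_iff)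
    moreover have "Imp (Univ \<phi>) (Neg (Neg (Univ \<phi>))) \<in> {\<phi>. Univ \<phi> \<in> y}"
      using L by (intro deductive_valid[OF Univ_deductive[OF yw]]) (auto simp: boolean_valuation_def)
    ultimately show False
      using deductive_mp[OF Univ_deductive[OF yw]] Univ_Univ[OF yw \<phi>] by blast
  qed
qed

lemma sphere_refl:
  assumes x: "world x" shows "x \<in> sphere x"
proof -
  have "\<phi> \<in> x" if "Univ \<phi> \<in> x" for \<phi>
  proof -
    have "\<phi> \<in> L" using world_L[OF x that] by (simp add: Univ_L_iff)
    then show ?thesis
      using world_mp[OF x subsetD[OF U_T U_axioms.Univ_T] that] by blast
  qed
  then show ?thesis using x by (simp add: sphere_def)
qed

lemma canonical_sphere:
  assumes x: "world x"
  shows "tangle_worlds L (sphere x) {(y, z). y \<in> sphere x \<and> z \<in> sphere x \<and> acc y z}"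
proof (rule canonical)
  show "world y" if "y \<in> sphere x" for y using that by (simp add: sphere_def)
  fix y assume y: "y \<in> sphere x"
  then have yw: "world y" by (simp add: sphere_def)
  show "z \<in> sphere x" if "world z" "acc y z" for z
  proof -
    have "\<phi> \<in> z" if "Univ \<phi> \<in> x" for \<phi>
    proof -
      have "Univ \<phi> \<in> y" using Univ_sphere[OF x y] that by blast
      moreover have "\<phi> \<in> L" using world_L[OF x that] by (simp add: Univ_L_iff)
      ultimately have "Box \<phi> \<in> y"
        using subsetD[OF U_T U_axioms.Univ_Box] world_mp[OF yw, of "Univ \<phi>" "Box \<phi>"] by simp
      then show ?thesis using \<open>acc y z\<close> by (auto simp: acc_def)
    qed
    then show ?thesis using \<open>world z\<close> by (simp add: sphere_def)
  qed
  fix \<phi> assume L: "Univ \<phi> \<in> L"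
  then have "\<phi> \<in> L" by (simp add: Univ_L_iff)
  have "Univ \<phi> \<in> x" if all: "\<forall>z\<in>sphere x. \<phi> \<in> z"
  proof (rule ccontr)
    assume "Univ \<phi> \<notin> x"
    then obtain z where "world z" "{\<phi>. Univ \<phi> \<in> x} \<subseteq> z" "\<phi> \<notin> z"
      using lindenbaum[OF Univ_deductive[OF x] \<open>\<phi> \<in> L\<close>] by blast
    then show False using all by (auto simp: sphere_def)
  qed
  then have "Univ \<phi> \<in> x \<longleftrightarrow> (\<forall>z\<in>sphere x. \<phi> \<in> z)" by (auto simp: sphere_def)
  then show "Univ \<phi> \<in> y \<longleftrightarrow> (\<forall>z\<in>sphere x. \<phi> \<in> z)" using Univ_sphere[OF x y] by blast
qed

lemma universal_model:
  assumes "G_axioms n L \<subseteq> T" "\<phi> \<in> L" "Neg \<phi> \<notin> T"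
  shows "\<exists>F :: nat frame. F \<in> lc_trans_frames n \<and> (Dia Top \<in> T \<longrightarrow> serial_frame F) \<and>
    (C_axioms L \<subseteq> T \<longrightarrow> path_connected_frame F) \<and>
    finite (fst F) \<and> (\<exists>h. (\<forall>p. h p \<subseteq> fst F) \<and> (\<exists>w\<in>fst F. sat F h w \<phi>))"
proof -
  obtain x where x: "world x" "\<phi> \<in> x" using consistent_world assms by blast
  interpret tangle_worlds L "sphere x" "{(y, z). y \<in> sphere x \<and> z \<in> sphere x \<and> acc y z}"
    by (rule canonical_sphere[OF x(1)])
  have sw: "world y" if "y \<in> sphere x" for y using that by (simp add: sphere_def)
  have "G_axioms n L \<subseteq> y" if "y \<in> sphere x" for y
    using sw[OF that] assms(1) G_axioms_L[of n] world_T by blast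
  with x assms(2) sphere_refl[OF x(1)] obtain F :: "nat frame" and h w where
    "F \<in> lc_trans_frames n" "finite (fst F)" "\<forall>p. h p \<subseteq> fst F" "w \<in> fst F" "sat F h w \<phi>"
    "(\<And>y. y \<in> sphere x \<Longrightarrow> Dia Top \<in> y) \<Longrightarrow> serial_frame F"
    "(\<And>y. y \<in> sphere x \<Longrightarrow> C_axioms L \<subseteq> y) \<Longrightarrow> (\<And>\<phi>. \<phi> \<in> L \<Longrightarrow> Univ \<phi> \<in> L) \<Longrightarrow> path_connected_frame F"
    by (elim finite_model[rotated 3]) auto
  moreover have "Dia Top \<in> y" if "Dia Top \<in> T" "y \<in> sphere x" for y
    using that sw world_T[of y "Dia Top"] by simp
  moreover have "C_axioms L \<subseteq> y" if "C_axioms L \<subseteq> T" "y \<in> sphere x" for y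
  proof -
    have "C_axioms L \<subseteq> L" by (auto simp: C_axioms_def Univ_L_iff)
    then show ?thesis using that sw world_T by blast
  qed
  ultimately show ?thesis using Univ_L_iff by blast
qed

end

inductive_cases lang_box_cases: "Neg \<phi> \<in> lang_box" "And \<phi> \<psi> \<in> lang_box" "Box \<phi> \<in> lang_box"
  "Univ \<phi> \<in> lang_box" "Tangle \<Gamma> \<in> lang_box"

inductive_cases lang_all_cases: "Neg \<phi> \<in> lang_all" "And \<phi> \<psi> \<in> lang_all" "Box \<phi> \<in> lang_all"
  "Univ \<phi> \<in> lang_all" "Tangle \<Gamma> \<in> lang_all"

interpretation box: language lang_box
  by unfold_locales (auto intro: lang_box.intros elim: lang_box_cases)

interpretation all: language lang_all
  by unfold_locales (auto intro: lang_all.intros elim: lang_all_cases)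

lemma finite_model_propertyI:
  assumes "\<And>\<phi>. \<phi> \<in> lang H \<Longrightarrow> Neg \<phi> \<notin> theorems_of H \<Longrightarrow>
    \<exists>F\<in>\<K>. finite (fst F) \<and> (\<exists>h. (\<forall>p. h p \<subseteq> fst F) \<and> (\<exists>w\<in>fst F. sat F h w \<phi>))"
  shows "finite_model_property H \<K>"
  using assms by (simp add: finite_model_property_def consistent_def)

lemma finite_model_property_mono:
  assumes "finite_model_property H \<K>" "\<K> \<subseteq> \<L>"
  shows "finite_model_property H \<L>"
proof (rule finite_model_propertyI)
  let ?P = "\<lambda>F \<phi>. finite (fst F) \<and> (\<exists>h. (\<forall>p. h p \<subseteq> fst F) \<and> (\<exists>w\<in>fst F. sat F h w \<phi>))"
  fix \<phi> assume "\<phi> \<in> lang H" "Neg \<phi> \<notin> theorems_of H"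
  then have "\<exists>F\<in>\<K>. ?P F \<phi>"
    using assms(1) by (simp add: finite_model_property_def consistent_def)
  then obtain F where F: "F \<in> \<K>" "?P F \<phi>" by (rule bexE)
  show "\<exists>F\<in>\<L>. ?P F \<phi>" by (rule bexI[of "\<lambda>F. ?P F \<phi>", OF F(2) subsetD[OF assms(2) F(1)]])
qed

lemma fmp_sys:
  assumes "K4Gt n lang_box \<subseteq> S lang_box"
  shows "finite_model_property (sys S)
    {F \<in> lc_trans_frames n. Dia Top \<in> S lang_box \<longrightarrow> serial_frame F}"
    (is "finite_model_property _ ?K")
proof (rule finite_model_propertyI)
  let ?T = "theorems_of (sys S)"
  have ax: "S lang_box \<subseteq> ?T" by (auto simp: sys_def intro: theorems_of.ax)
  interpret tangle_logic lang_box ?T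
    using ax assms
    by unfold_locales (auto simp: K4Gt_def sys_def intro: theorems_of.mp theorems_of.nec)
  have U: "Univ \<phi> \<notin> lang_box" for \<phi> :: "'a fm" by (auto elim: lang_box_cases)
  have G: "G_axioms n lang_box \<subseteq> ?T" using ax assms by (auto simp: K4Gt_def)
  fix \<phi> assume "\<phi> \<in> lang (sys S)" and cons: "Neg \<phi> \<notin> ?T"
  then have "\<phi> \<in> lang_box" by (simp add: sys_def)
  from box_model[OF U G this cons] obtain F :: "nat frame" and h where F: "F \<in> lc_trans_frames n"
    "Dia Top \<in> ?T \<longrightarrow> serial_frame F" "finite (fst F)"
    "\<forall>p. h p \<subseteq> fst F" "\<exists>w\<in>fst F. sat F h w \<phi>"
    by (elim exE conjE)
  have "F \<in> ?K"
    using F(1,2) subsetD[OF ax] by simp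
  then show "\<exists>F\<in>?K. finite (fst F) \<and> (\<exists>h. (\<forall>p. h p \<subseteq> fst F) \<and> (\<exists>w\<in>fst F. sat F h w \<phi>))"
    using F(3-5) by (intro bexI[of _ F] conjI exI[of _ h])
qed

lemma tangle_logic_U_lang_all:
  assumes "K4Gt n lang_all \<subseteq> axms H" "U_axioms lang_all \<subseteq> axms H" "necs H = {Box, Univ}"
  shows "tangle_logic_U lang_all (theorems_of H)"
proof unfold_locales
  have ax: "axms H \<subseteq> theorems_of H" by (auto intro: theorems_of.ax)
  show "K4t lang_all \<subseteq> theorems_of H" "U_axioms lang_all \<subseteq> theorems_of H"
    using assms ax by (auto simp: K4Gt_def)
  show "Univ \<phi> \<in> lang_all \<longleftrightarrow> \<phi> \<in> lang_all" for \<phi> :: "'a fm"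
    by (auto intro: lang_all.intros elim: lang_all_cases)
qed (use assms in \<open>auto intro: theorems_of.mp theorems_of.nec\<close>)

lemma fmp_universal:
  assumes "lang H = lang_all" "necs H = {Box, Univ}"
    and "K4Gt n lang_all \<subseteq> axms H" "U_axioms lang_all \<subseteq> axms H"
  shows "finite_model_property H {F \<in> lc_trans_frames n. (Dia Top \<in> axms H \<longrightarrow> serial_frame F) \<and>
    (C_axioms lang_all \<subseteq> axms H \<longrightarrow> path_connected_frame F)}" (is "finite_model_property H ?K")
proof (rule finite_model_propertyI)
  interpret tangle_logic_U lang_all "theorems_of H"
    using tangle_logic_U_lang_all assms by blast
  have ax: "axms H \<subseteq> theorems_of H" by (auto intro: theorems_of.ax)
  have G: "G_axioms n lang_all \<subseteq> theorems_of H" using ax assms by (auto simp: K4Gt_def)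
  fix \<phi> assume "\<phi> \<in> lang H" and cons: "Neg \<phi> \<notin> theorems_of H"
  then have "\<phi> \<in> lang_all" using assms(1) by simp
  from universal_model[OF G this cons] obtain F :: "nat frame" and h where F: "F \<in> lc_trans_frames n"
    "Dia Top \<in> theorems_of H \<longrightarrow> serial_frame F"
    "C_axioms lang_all \<subseteq> theorems_of H \<longrightarrow> path_connected_frame F" "finite (fst F)"
    "\<forall>p. h p \<subseteq> fst F" "\<exists>w\<in>fst F. sat F h w \<phi>"
    by (elim exE conjE)
  have "F \<in> ?K" using F(1,2,3) subsetD[OF ax] subset_trans[OF _ ax] by simp
  then show "\<exists>F\<in>?K. finite (fst F) \<and> (\<exists>h. (\<forall>p. h p \<subseteq> fst F) \<and> (\<exists>w\<in>fst F. sat F h w \<phi>))"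
    using F(4-6) by (intro bexI[of _ F] conjI exI[of _ h])
qed

theorem mainTheorem14:
  fixes n :: nat
  assumes "n \<ge> 1"
  shows "finite_model_property (sys (K4Gt n) :: 'v system) (lc_trans_frames n)
    \<and> finite_model_property (sys_U (K4Gt n) :: 'v system) (lc_trans_frames n)
    \<and> finite_model_property (sys_UC (K4Gt n) :: 'v system)
        {F \<in> lc_trans_frames n. path_connected_frame F}
    \<and> finite_model_property (sys (KD4Gt n) :: 'v system)
        {F \<in> lc_trans_frames n. serial_frame F}
    \<and> finite_model_property (sys_U (KD4Gt n) :: 'v system)
        {F \<in> lc_trans_frames n. serial_frame F}
    \<and> finite_model_property (sys_UC (KD4Gt n) :: 'v system)
        {F \<in> lc_trans_frames n. path_connected_frame F \<and> serial_frame F}"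
proof (intro conjI)
  note box = fmp_sys[of n, THEN finite_model_property_mono]
    and univ = fmp_universal[of _ n, THEN finite_model_property_mono]
  show "finite_model_property (sys (K4Gt n) :: 'v system) (lc_trans_frames n)"
    by (rule box) auto
  show "finite_model_property (sys (KD4Gt n) :: 'v system) {F \<in> lc_trans_frames n. serial_frame F}"
    by (rule box) (auto simp: KD4Gt_def)
  show "finite_model_property (sys_U (K4Gt n) :: 'v system) (lc_trans_frames n)"
    by (rule univ) (auto simp: sys_U_def)
  show "finite_model_property (sys_UC (K4Gt n) :: 'v system)
      {F \<in> lc_trans_frames n. path_connected_frame F}"
    by (rule univ) (auto simp: sys_UC_def)
  show "finite_model_property (sys_U (KD4Gt n) :: 'v system)
      {F \<in> lc_trans_frames n. serial_frame F}"
    by (rule univ) (auto simp: sys_U_def KD4Gt_def)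
  show "finite_model_property (sys_UC (KD4Gt n) :: 'v system)
      {F \<in> lc_trans_frames n. path_connected_frame F \<and> serial_frame F}"
    by (rule univ) (auto simp: sys_UC_def KD4Gt_def)
qed

end
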